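(* Let $t\in(0,\sqrt2)$ and $d\in[0,1/2]$. Let $(N_k)_k$ and $(n_k)_k$ be sequences of positive integers with $N_k\to+\infty$, $n_k\le N_k/2+1$ for all $k$, and $n_k/N_k\to d$, and let $(\boldsymbol{\alpha}^{(k)}_j(t))_{1\le j\le n_k}$ be the associated Bethe roots. Let $f:(0,+\infty)\to(0,+\infty)$ be a continuous, decreasing and integrable function. Then $$\frac{1}{N_k}\sum_{j=\lceil n_k/2\rceil+1}^{n_k} f\left(\boldsymbol{\alpha}^{(k)}_j(t)\right)\ \longrightarrow\ \int_0^{\boldsymbol{\xi}_{t,d}^{-1}(d)} f(\alpha)\,\boldsymbol{\xi}'_{t,d}(\alpha)\,d\alpha\qquad (k\to+\infty),$$ where by convention $\boldsymbol{\xi}_{t,1/2}^{-1}(1/2)=+\infty$.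
   Context: Let $\mu:(-1,1)\to(0,\pi)$ be the inverse of $\cos:(0,\pi)\to(-1,1)$. For $t\in(0,\sqrt2]$ put $\Delta_t=\frac{2-t^2}{2}$, $\mu_t=\mu(-\Delta_t)$, $I_t=(-(\pi-\mu_t),\pi-\mu_t)$. $\Theta:(t,x,y)\mapsto\Theta_t(x,y)$ is the unique real analytic function on $\{(t,x,y):x,y\in I_t\}$ with $\Theta_{\sqrt2}(0,0)=0$ and $\exp(-i\Theta_t(x,y))=e^{i(x-y)}\frac{e^{-ix}+e^{iy}-2\Delta_t}{e^{-iy}+e^{ix}-2\Delta_t}$. $\kappa:(t,\alpha)\mapsto\kappa_t(\alpha)$ is the unique analytic map $(0,\sqrt2)\times\mathbb{R}\to\mathbb{R}$ with $\kappa_{\sqrt2/2}(0)=0$ and $e^{i\kappa_t(\alpha)}=\frac{e^{i\mu_t}-e^{\alpha}}{e^{i\mu_t+\alpha}-1}$; each $\kappa_t$ is an increasing bijection $\mathbb{R}\to I_t$. Put $\theta_t(\alpha,\beta)=\Theta_t(\kappa_t(\alpha),\kappa_t(\beta))$. Bethe roots: for each $k$, the real numbers $\boldsymbol{\alpha}^{(k)}_j(t)$, $1\le j\le n_k$, are such that $\mathbf{p}_j=\kappa_t(\boldsymbol{\alpha}^{(k)}_j(t))\in I_t$ is the solution of the system of Bethe equations $$N_k\mathbf{p}_j=2\pi j-(n_k+1)\pi-\sum_{l=1}^{n_k}\Theta_t(\mathbf{p}_j,\mathbf{p}_l),\qquad 1\le j\le n_k.$$ Counting functions: $\xi^{(k)}_t:\mathbb{R}\to\mathbb{R}$,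 $\xi_t^{(k)}(\alpha)=\frac{1}{2\pi}\kappa_t(\alpha)+\frac{n_k+1}{2N_k}+\frac{1}{2\pi N_k}\sum_{j=1}^{n_k}\theta_t(\alpha,\boldsymbol{\alpha}^{(k)}_j(t))$; they are increasing. The function $\boldsymbol{\xi}_{t,d}:\mathbb{R}\to\mathbb{R}$ is the limit of $(\xi_t^{(k)})_k$ as $k\to+\infty$, uniformly on every compact; this limit exists, is differentiable and strictly increasing, and depends only on $t$ and $d$. *)

theory Defs
  imports "HOL-Analysis.Analysis"
begin

(* Real analyticity in several variables: near every point p of S, f agrees on S with the sum of
   a power series centred at p. A multi-index is a function m on Basis, with monomial
   prod over b of ((x - p) . b) ^ m b. The series has to converge on a full neighbourhood of p,
   which matters where S is not open (below: on the face t = sqrt 2). *)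
definition real_analytic_on :: "('a::euclidean_space \<Rightarrow> real) \<Rightarrow> 'a set \<Rightarrow> bool" where
  "real_analytic_on f S \<longleftrightarrow>
    (\<forall>p\<in>S. \<exists>r>0. \<exists>c :: ('a \<Rightarrow> nat) \<Rightarrow> real. \<exists>g :: 'a \<Rightarrow> real.
      (\<forall>x\<in>ball p r.
        ((\<lambda>m. c m * (\<Prod>b\<in>Basis. ((x - p) \<bullet> b) ^ m b)) has_sum g x) (Basis \<rightarrow>\<^sub>E UNIV)) \<and>
      (\<forall>x\<in>ball p r \<inter> S. f x = g x))"

definition Delta :: "real \<Rightarrow> real" where
  "Delta t = (2 - t\<^sup>2) / 2"

definition mu :: "real \<Rightarrow> real" where
  "mu t = arccos (- Delta t)"

definition I_set :: "real \<Rightarrow> real set" where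
  "I_set t = {-(pi - mu t)<..<pi - mu t}"

(* is_Theta and is_kappa are the defining properties of Theta and kappa. The domains are connected,
   so each property determines the function on its domain; values elsewhere are irrelevant. *)
definition is_Theta :: "(real \<Rightarrow> real \<Rightarrow> real \<Rightarrow> real) \<Rightarrow> bool" where
  "is_Theta \<Theta> \<longleftrightarrow>
    real_analytic_on (\<lambda>(t, x, y). \<Theta> t x y)
      {(t, x, y). t \<in> {0<..sqrt 2} \<and> x \<in> I_set t \<and> y \<in> I_set t} \<and>
    \<Theta> (sqrt 2) 0 0 = 0 \<and>
    (\<forall>t\<in>{0<..sqrt 2}. \<forall>x\<in>I_set t. \<forall>y\<in>I_set t.
      exp (- \<i> * of_real (\<Theta> t x y)) =
        exp (\<i> * of_real (x - y)) *
        ((exp (- \<i> * of_real x) + exp (\<i> * of_real y) - 2 * of_real (Delta t)) /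
         (exp (- \<i> * of_real y) + exp (\<i> * of_real x) - 2 * of_real (Delta t))))"

definition is_kappa :: "(real \<Rightarrow> real \<Rightarrow> real) \<Rightarrow> bool" where
  "is_kappa \<kappa> \<longleftrightarrow>
    real_analytic_on (\<lambda>(t, \<alpha>). \<kappa> t \<alpha>) ({0<..<sqrt 2} \<times> UNIV) \<and>
    \<kappa> (sqrt 2 / 2) 0 = 0 \<and>
    (\<forall>t\<in>{0<..<sqrt 2}. \<forall>\<alpha>.
      exp (\<i> * of_real (\<kappa> t \<alpha>)) =
        (exp (\<i> * of_real (mu t)) - exp (of_real \<alpha>)) /
        (exp (\<i> * of_real (mu t) + of_real \<alpha>) - 1))"

definition theta ::
  "(real \<Rightarrow> real \<Rightarrow> real \<Rightarrow> real) \<Rightarrow> (real \<Rightarrow> real \<Rightarrow> real) \<Rightarrow> real \<Rightarrow> real \<Rightarrow> real \<Rightarrow> real" where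
  "theta \<Theta> \<kappa> t \<alpha> \<beta> = \<Theta> t (\<kappa> t \<alpha>) (\<kappa> t \<beta>)"

(* The roots are a 1, ..., a n; other values of a are irrelevant. *)
definition bethe_roots ::
  "(real \<Rightarrow> real \<Rightarrow> real \<Rightarrow> real) \<Rightarrow> (real \<Rightarrow> real \<Rightarrow> real) \<Rightarrow> real \<Rightarrow> nat \<Rightarrow> nat \<Rightarrow> (nat \<Rightarrow> real) \<Rightarrow> bool" where
  "bethe_roots \<Theta> \<kappa> t N n a \<longleftrightarrow>
    (\<forall>j\<in>{1..n}. \<kappa> t (a j) \<in> I_set t \<and>
      real N * \<kappa> t (a j) =
        2 * pi * real j - (real n + 1) * pi - (\<Sum>l=1..n. \<Theta> t (\<kappa> t (a j)) (\<kappa> t (a l))))"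

definition counting_fun ::
  "(real \<Rightarrow> real \<Rightarrow> real \<Rightarrow> real) \<Rightarrow> (real \<Rightarrow> real \<Rightarrow> real) \<Rightarrow> real \<Rightarrow> nat \<Rightarrow> nat \<Rightarrow> (nat \<Rightarrow> real)
    \<Rightarrow> real \<Rightarrow> real" where
  "counting_fun \<Theta> \<kappa> t N n a \<alpha> =
    1 / (2 * pi) * \<kappa> t \<alpha> + (real n + 1) / (2 * real N) +
    1 / (2 * pi * real N) * (\<Sum>j=1..n. theta \<Theta> \<kappa> t \<alpha> (a j))"

(* The value at d of the inverse of xi, with the convention that it is infinite for d = 1/2. *)
definition xi_inv :: "(real \<Rightarrow> real) \<Rightarrow> real \<Rightarrow> ereal" where
  "xi_inv \<xi> d = (if d = 1/2 then \<infinity> else ereal (inv \<xi> d))"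

end

theory Submission
  imports Defs
begin

text \<open>In the rapidity variables the problem becomes one about two explicit increasing functions. Put
  \<open>phase c x = 2 * arctan (c * tanh (x / 2))\<close>. Comparing exponentials on connected sets shows that
  \<open>\<kappa>\<^sub>t = phase (cot (mu t / 2))\<close> and \<open>\<theta>\<^sub>t(\<alpha>, \<beta>) = phase (- cot (mu t)) (\<alpha> - \<beta>)\<close>, both with positive
  parameter (\<open>kappa_eq_phase\<close>, \<open>theta_eq_phase\<close>). Hence the counting functions are strictly
  increasing with value \<open>j / N\<^sub>k\<close> at the \<open>j\<close>-th root, their derivatives are uniformly bounded and
  uniformly Lipschitz, so that \<open>\<xi>\<close> is continuously differentiable
  (\<open>derivative_of_limit_Lipschitz\<close>), and a maximum principle makes the solution of the Bethe
  equations unique and therefore symmetric (\<open>root_reflect\<close>). Symmetry gives \<open>\<xi> 0 = d / 2\<close> and shows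
  that the roots in the sum are positive.

  The main point is that no roots are lost at infinity: \<open>\<xi>\<close> takes values above \<open>d\<close> if \<open>d < 1 / 2\<close>
  and tends to \<open>1 / 2\<close> if \<open>d = 1 / 2\<close> (\<open>\<xi>_exceeds\<close>, \<open>\<xi>_less_half\<close>). So \<open>\<xi>\<close> maps \<open>(0, \<xi>\<^sup>-\<^sup>1(d))\<close> onto
  \<open>(d / 2, d)\<close>.

  The sum is the integral of a step function whose value at \<open>u\<close> is \<open>f\<close> at the root with index
  \<open>\<lceil>n\<^sub>k / 2\<rceil> + \<lceil>N\<^sub>k u\<rceil>\<close>. This value tends to \<open>f (\<xi>\<^sup>-\<^sup>1(d / 2 + u))\<close> for \<open>0 < u < d / 2\<close> and to \<open>0\<close> for
  \<open>u > d / 2\<close> (\<open>step_tendsto\<close>). If \<open>C\<close> bounds the slopes of the counting functions, that root is at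
  least \<open>u / (2 * C)\<close>, so the step functions are dominated by the integrable function
  \<open>u \<mapsto> f (u / (2 * C))\<close> (\<open>step_bound\<close>). Dominated convergence and the substitution \<open>u = \<xi> \<alpha> - d / 2\<close>
  give the result.\<close>

section \<open>Continuous phases of unit complex numbers\<close>

lemma real_analytic_on_imp_continuous_on:
  fixes f :: "'a::euclidean_space \<Rightarrow> real"
  assumes "real_analytic_on f S"
  shows "continuous_on S f"
proof (unfold continuous_on_iff, intro ballI allI impI)
  fix p and e :: real
  assume p: "p \<in> S" and e: "e > 0"
  define T where "T c x m = c m * (\<Prod>b\<in>Basis. ((x - p) \<bullet> b) ^ m b)"
    for c :: "('a \<Rightarrow> nat) \<Rightarrow> real" and x m
  have "\<exists>r>0. \<exists>c g. (\<forall>x\<in>ball p r. (T c x has_sum g x) (Basis \<rightarrow>\<^sub>E UNIV)) \<and>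
      (\<forall>x\<in>ball p r \<inter> S. f x = g x)"
    using assms p unfolding real_analytic_on_def T_def[abs_def] by (rule bspec)
  then obtain r c g where r: "r > 0"
    and all: "\<forall>x\<in>ball p r. (T c x has_sum g x) (Basis \<rightarrow>\<^sub>E UNIV)"
      "\<forall>x\<in>ball p r \<inter> S. f x = g x"
    by (elim exE conjE) (rule that)
  have g: "(T c x has_sum g x) (Basis \<rightarrow>\<^sub>E UNIV)" if "x \<in> ball p r" for x
    using all(1) that by (rule bspec)
  have fg: "f x = g x" if "x \<in> ball p r \<inter> S" for x
    using all(2) that by (rule bspec)
  define s where "s = r / (2 * real DIM('a))"
  have s: "s > 0" using r by (simp add: s_def)
  \<comment> \<open>All displacements of \<open>x0\<close> from \<open>p\<close> equal \<open>s\<close>, so the series at \<open>x0\<close> majorises the series nearby.\<close>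
  define x0 where "x0 = p + (\<Sum>b\<in>Basis. s *\<^sub>R b)"
  have x0b: "(x0 - p) \<bullet> b = s" if "b \<in> Basis" for b
    using that by (simp add: x0_def)
  have "norm (x0 - p) \<le> (\<Sum>b\<in>Basis. \<bar>(x0 - p) \<bullet> b\<bar>)" by (rule norm_le_l1)
  also have "\<dots> = real DIM('a) * s" using s x0b by simp
  also have "\<dots> < r" using r by (simp add: s_def)
  finally have x0: "x0 \<in> ball p r" by (simp add: dist_norm norm_minus_commute)
  have "T c x0 summable_on (Basis \<rightarrow>\<^sub>E UNIV)"
    using has_sum_imp_summable[OF g[OF x0]] .
  then have "(\<lambda>m. \<bar>T c x0 m\<bar>) summable_on (Basis \<rightarrow>\<^sub>E UNIV)"
    by (subst (asm) summable_on_iff_abs_summable_on_real) simp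
  then obtain K where K: "((\<lambda>m. \<bar>T c x0 m\<bar>) has_sum K) (Basis \<rightarrow>\<^sub>E UNIV)"
    unfolding summable_on_def by auto
  have K0: "K \<ge> 0" by (rule has_sum_nonneg[OF K]) auto
  define \<delta> where "\<delta> = min 1 (e / (2 * (K + 1)))"
  have \<delta>: "\<delta> > 0" "\<delta> \<le> 1" "\<delta> * K < e"
  proof -
    show "\<delta> > 0" "\<delta> \<le> 1" using e K0 by (auto simp: \<delta>_def)
    have "\<delta> * K \<le> e / (2 * (K + 1)) * K" by (intro mult_right_mono K0) (simp add: \<delta>_def)
    also have "\<dots> < e / (2 * (K + 1)) * (2 * (K + 1))"
      using e K0 by (intro mult_strict_left_mono divide_pos_pos) auto
    also have "\<dots> = e" using K0 by simp
    finally show "\<delta> * K < e" .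
  qed
  define \<rho> where "\<rho> = min r (\<delta> * s)"
  have \<rho>: "\<rho> > 0" using r s \<delta> by (simp add: \<rho>_def)
  have "dist (f x) (f p) < e" if x: "x \<in> S" "dist x p < \<rho>" for x
  proof -
    have xr: "x \<in> ball p r" using x by (simp add: \<rho>_def dist_commute)
    have xb: "\<bar>(x - p) \<bullet> b\<bar> \<le> \<delta> * s" if "b \<in> Basis" for b
      using Basis_le_norm[OF that, of "x - p"] x by (simp add: \<rho>_def dist_norm)
    have bound: "\<bar>T c x m - T c p m\<bar> \<le> \<delta> * \<bar>T c x0 m\<bar>" for m
    proof (cases "\<forall>b\<in>Basis. m b = 0")
      case True
      then show ?thesis using \<delta> by (simp add: T_def)
    next
      case False
      then obtain b0 where b0: "b0 \<in> Basis" "m b0 \<noteq> 0" by auto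
      have "(\<Prod>b\<in>Basis. ((p - p) \<bullet> b) ^ m b) = 0"
        using b0 by (intro prod_zero) (auto simp: power_0_left)
      then have p0: "T c p m = 0" by (simp add: T_def)
      have "\<bar>\<Prod>b\<in>Basis. ((x - p) \<bullet> b) ^ m b\<bar> = (\<Prod>b\<in>Basis. \<bar>(x - p) \<bullet> b\<bar> ^ m b)"
        by (simp add: abs_prod power_abs)
      also have "\<dots> \<le> (\<Prod>b\<in>Basis. (\<delta> * s) ^ m b)"
        by (intro prod_mono conjI power_mono xb) auto
      also have "\<dots> = (\<Prod>b\<in>Basis. \<delta> ^ m b) * (\<Prod>b\<in>Basis. s ^ m b)"
        by (simp add: power_mult_distrib prod.distrib)
      also have "\<dots> \<le> \<delta> * (\<Prod>b\<in>Basis. s ^ m b)"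
      proof (intro mult_right_mono prod_nonneg)
        have "(\<Prod>b\<in>Basis. \<delta> ^ m b) = \<delta> ^ m b0 * (\<Prod>b\<in>Basis - {b0}. \<delta> ^ m b)"
          using b0 by (simp add: prod.remove)
        also have "\<dots> \<le> \<delta> ^ m b0 * 1"
          using \<delta> by (intro mult_left_mono prod_le_1) (auto simp: power_le_one)
        also have "\<delta> ^ m b0 * 1 \<le> \<delta>"
          using \<delta> b0 power_decreasing[of 1 "m b0" \<delta>] by simp
        finally show "(\<Prod>b\<in>Basis. \<delta> ^ m b) \<le> \<delta>" by simp
      qed (use s in auto)
      finally have "\<bar>\<Prod>b\<in>Basis. ((x - p) \<bullet> b) ^ m b\<bar> \<le> \<delta> * (\<Prod>b\<in>Basis. s ^ m b)" .
      then have "\<bar>c m\<bar> * \<bar>\<Prod>b\<in>Basis. ((x - p) \<bullet> b) ^ m b\<bar> \<le> \<bar>c m\<bar> * (\<delta> * (\<Prod>b\<in>Basis. s ^ m b))"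
        by (intro mult_left_mono) auto
      moreover have "\<bar>T c x0 m\<bar> = \<bar>c m\<bar> * (\<Prod>b\<in>Basis. s ^ m b)"
        using s x0b by (simp add: T_def abs_mult prod_nonneg)
      moreover have "\<bar>T c x m - T c p m\<bar> = \<bar>c m\<bar> * \<bar>\<Prod>b\<in>Basis. ((x - p) \<bullet> b) ^ m b\<bar>"
        unfolding p0 by (simp add: T_def abs_mult)
      ultimately show ?thesis by (simp add: mult_ac)
    qed
    have d1: "((\<lambda>m. T c x m - T c p m) has_sum (g x - g p)) (Basis \<rightarrow>\<^sub>E UNIV)"
    proof -
      have "((\<lambda>m. - T c p m) has_sum - g p) (Basis \<rightarrow>\<^sub>E UNIV)"
        using g[of p] r by (simp only: has_sum_uminus minus_minus centre_in_ball)
      from has_sum_add[OF g[OF xr] this] show ?thesis by simp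
    qed
    have d3: "((\<lambda>m. - (T c x m - T c p m)) has_sum - (g x - g p)) (Basis \<rightarrow>\<^sub>E UNIV)"
      using d1 by (simp only: has_sum_uminus minus_minus)
    have d2: "((\<lambda>m. \<delta> * \<bar>T c x0 m\<bar>) has_sum (\<delta> * K)) (Basis \<rightarrow>\<^sub>E UNIV)"
      by (intro has_sum_cmult_right K)
    have "g x - g p \<le> \<delta> * K"
      by (rule has_sum_mono[OF d1 d2]) (use bound in \<open>simp add: abs_le_iff\<close>)
    moreover have "- (g x - g p) \<le> \<delta> * K"
      by (rule has_sum_mono[OF d3 d2]) (use bound in \<open>simp add: abs_le_iff\<close>)
    moreover have "f x = g x" "f p = g p" using fg x xr p r by auto
    ultimately show ?thesis using \<delta> by (simp add: dist_real_def)
  qed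
  then show "\<exists>\<rho>>0. \<forall>x\<in>S. dist x p < \<rho> \<longrightarrow> dist (f x) (f p) < e"
    using \<rho> by blast
qed

text \<open>A continuous phase on a connected set is determined by its exponential and one value: two such
  phases differ by a continuous function with values in \<open>2 * pi * \<int>\<close>. This is how the analytic
  characterisations of \<open>\<Theta>\<close> and \<open>\<kappa>\<close> are used.\<close>

lemma exp_i_eq_imp_eq_on_connected:
  fixes h k :: "'a::topological_space \<Rightarrow> real"
  assumes conn: "connected S" and h: "continuous_on S h" and k: "continuous_on S k"
    and eq: "\<And>x. x \<in> S \<Longrightarrow> exp (\<i> * of_real (h x)) = exp (\<i> * of_real (k x))"
    and p: "p \<in> S" "h p = k p" and x: "x \<in> S"
  shows "h x = k x"
proof (rule ccontr)
  assume ne: "h x \<noteq> k x"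
  define g where "g y = \<bar>h y - k y\<bar>" for y
  have g: "continuous_on S g" unfolding g_def by (intro continuous_intros h k)
  have iv: "is_interval (g ` S)"
    using connected_continuous_image[OF g conn] by (simp add: is_interval_connected_1)
  \<comment> \<open>A value of \<open>g\<close> in \<open>(0, 1]\<close> cannot be a multiple of \<open>2 * pi\<close>.\<close>
  define v where "v = min (g x) 1"
  have v: "0 < v" "v \<le> g x" "v \<le> 1" using ne by (auto simp: v_def g_def)
  have "g p = 0" using p by (simp add: g_def)
  then have "v \<in> g ` S"
    using iv v p(1) x unfolding is_interval_1
    by (metis image_eqI less_imp_le)
  then obtain y where y: "y \<in> S" "v = g y" by auto
  have "exp (\<i> * of_real (h y - k y)) = (1::complex)"
    using eq[OF y(1)] by (simp add: right_diff_distrib exp_diff)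
  then have "cos (h y - k y) = 1"
    by (metis cis_conv_exp cis.sel(1) one_complex.sel(1))
  then have "cos v = 1" unfolding y(2) g_def by simp
  then show False using v cos_monotone_0_pi[of 0 v] pi_gt3 by simp
qed

section \<open>The phase function\<close>

text \<open>Both \<open>\<kappa>\<^sub>t\<close> and \<open>\<theta>\<^sub>t\<close> are instances of this odd function: with \<open>c = cot (\<nu> / 2)\<close> it is the
  continuous phase, vanishing at \<open>0\<close>, of \<open>x \<mapsto> (e\<^sup>i\<^sup>\<nu> - e\<^sup>x) / (e\<^sup>i\<^sup>\<nu> e\<^sup>x - 1)\<close>. For \<open>c > 0\<close> it increases
  from \<open>- 2 * arctan c\<close> to \<open>2 * arctan c\<close>.\<close>

definition phase :: "real \<Rightarrow> real \<Rightarrow> real" where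
  "phase c x = 2 * arctan (c * tanh (x / 2))"

text \<open>The derivative of \<^term>\<open>phase c\<close>.\<close>

definition phase' :: "real \<Rightarrow> real \<Rightarrow> real" where
  "phase' c x = c * (1 - (tanh (x / 2))\<^sup>2) / (1 + (c * tanh (x / 2))\<^sup>2)"

lemma phase_0 [simp]: "phase c 0 = 0"
  and phase_minus: "phase c (- x) = - phase c x"
  and phase_minus_left: "phase (- c) x = - phase c x"
  by (simp_all add: phase_def arctan_minus)

lemma cosh_real_ne_0 [simp]: "cosh (x::real) \<noteq> 0"
  using cosh_real_pos[of x] by linarith

lemma continuous_on_phase [continuous_intros]:
  assumes "continuous_on S g" "continuous_on S h"
  shows "continuous_on S (\<lambda>x. phase (g x) (h x))"
  unfolding phase_def by (intro continuous_intros assms) auto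

lemma has_real_derivative_phase: "(phase c has_real_derivative phase' c x) (at x)"
  unfolding phase_def phase'_def
  by (rule derivative_eq_intros refl | simp)+ (simp add: field_simps)

lemma tanh_sq_le_1: "(tanh (x::real))\<^sup>2 \<le> 1"
  using tanh_real_bounds[of x] by (simp add: abs_square_le_1 abs_le_iff)

lemma phase'_bounds:
  assumes "c \<ge> 0"
  shows "0 \<le> phase' c x" "phase' c x \<le> c"
proof -
  define T where "T = tanh (x / 2)"
  have T: "T\<^sup>2 \<le> 1" unfolding T_def by (rule tanh_sq_le_1)
  have p: "0 < 1 + (c * T)\<^sup>2" by (intro add_pos_nonneg) auto
  show "0 \<le> phase' c x"
    unfolding phase'_def T_def[symmetric] using T assms p by (intro divide_nonneg_pos) auto
  have "c * (1 - T\<^sup>2) \<le> c * (1 + (c * T)\<^sup>2)"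
    using assms by (intro mult_left_mono) (auto intro: order_trans[of _ 1])
  then show "phase' c x \<le> c"
    unfolding phase'_def T_def[symmetric] using p by (simp add: field_simps)
qed

lemma phase'_Lipschitz:
  assumes "c \<ge> 0"
  shows "\<bar>phase' c x - phase' c y\<bar> \<le> c * (1 + c\<^sup>2) * \<bar>x - y\<bar>"
proof -
  define D where "D x = - (c * (1 + c\<^sup>2) * tanh (x / 2) * (1 - (tanh (x / 2))\<^sup>2) / (1 + (c * tanh (x / 2))\<^sup>2)\<^sup>2)"
    for x
  have der: "(phase' c has_real_derivative D x) (at x)" for x
  proof -
    have p: "1 + (c * tanh (x/2))\<^sup>2 \<noteq> 0"
      by (metis add_pos_nonneg less_irrefl zero_le_power2 zero_less_one)
    show ?thesis
      unfolding phase'_def D_def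
      apply (rule derivative_eq_intros refl p | simp)+
      using p by (simp add: divide_simps) (simp add: algebra_simps power2_eq_square)
  qed
  have bnd: "\<bar>D x\<bar> \<le> c * (1 + c\<^sup>2)" for x
  proof -
    define T where "T = tanh (x / 2)"
    have T: "\<bar>T\<bar> \<le> 1" "T\<^sup>2 \<le> 1"
      using tanh_real_bounds[of "x/2"] tanh_sq_le_1[of "x/2"] by (auto simp: T_def)
    have p: "1 \<le> (1 + (c * T)\<^sup>2)\<^sup>2" by (simp add: one_le_power)
    have "\<bar>D x\<bar> = c * (1 + c\<^sup>2) * (\<bar>T\<bar> * (1 - T\<^sup>2) / (1 + (c * T)\<^sup>2)\<^sup>2)"
      unfolding D_def T_def[symmetric] using assms T by (simp add: abs_mult)
    also have "\<dots> \<le> c * (1 + c\<^sup>2) * 1"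
    proof (intro mult_left_mono)
      have "\<bar>T\<bar> * (1 - T\<^sup>2) \<le> 1 * 1" using T by (intro mult_mono) auto
      then show "\<bar>T\<bar> * (1 - T\<^sup>2) / (1 + (c * T)\<^sup>2)\<^sup>2 \<le> 1"
        using p by (subst divide_le_eq_1_pos) linarith+
    qed (use assms in auto)
    finally show ?thesis by simp
  qed
  have "norm (phase' c x - phase' c y) \<le> c * (1 + c\<^sup>2) * norm (x - y)"
    by (rule field_differentiable_bound[of UNIV _ D])
      (use der bnd in \<open>auto intro: has_field_derivative_at_within\<close>)
  then show ?thesis by simp
qed

lemma phase_strict_mono:
  assumes "c > 0" "x < y"
  shows "phase c x < phase c y"
  using assms by (simp add: phase_def arctan_less_iff)

lemma phase_mono:
  assumes "c > 0" "x \<le> y"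
  shows "phase c x \<le> phase c y"
  using phase_strict_mono[OF assms(1)] assms(2) by (cases "x = y") (auto intro: less_imp_le)

lemma phase_less:
  assumes "c > 0"
  shows "phase c x < 2 * arctan c"
  using assms tanh_real_lt_1[of "x / 2"] by (simp add: phase_def arctan_less_iff)

lemma phase_tendsto_at_top: "(phase c \<longlongrightarrow> 2 * arctan c) at_top"
proof -
  have "filterlim (\<lambda>x::real. x / 2) at_top at_top"
    using filterlim_tendsto_pos_mult_at_top[OF tendsto_const _ filterlim_ident, of "1/2"] by simp
  then have "((\<lambda>x::real. tanh (x / 2)) \<longlongrightarrow> 1) at_top"
    by (rule filterlim_compose[OF tanh_real_at_top])
  then have "((\<lambda>x. 2 * arctan (c * tanh (x / 2))) \<longlongrightarrow> 2 * arctan (c * 1)) at_top"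
    by (intro tendsto_mult tendsto_arctan tendsto_const)
  then show ?thesis by (simp add: phase_def[abs_def])
qed

lemma exp_i_phase:
  fixes \<nu> x :: real
  assumes "sin (\<nu> / 2) \<noteq> 0"
  shows "exp (\<i> * of_real (phase (cot (\<nu> / 2)) x)) =
    (exp (\<i> * of_real \<nu>) - exp (of_real x)) / (exp (\<i> * of_real \<nu>) * exp (of_real x) - 1)"
proof -
  define s where "s = cot (\<nu> / 2) * tanh (x / 2)"
  define A where "A = exp x"
  define w where "w = cis (\<nu> / 2)"
  define Cs where "Cs = complex_of_real (cos (\<nu> / 2))"
  define Sn where "Sn = complex_of_real (sin (\<nu> / 2))"
  have A: "A > 0" by (simp add: A_def)
  have w: "w = Cs + \<i> * Sn" by (simp add: w_def Cs_def Sn_def complex_eq_iff)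
  have ww: "exp (\<i> * of_real \<nu>) = w * w" by (simp add: w_def cis_mult flip: cis_conv_exp)
  have CS: "Cs * Cs + Sn * Sn = 1"
    unfolding Cs_def Sn_def by (metis of_real_1 of_real_add of_real_mult sin_cos_squared_add3)
  have Sn0: "Sn \<noteq> 0" using assms by (simp add: Sn_def)
  have ex: "exp x = exp (x / 2) * exp (x / 2)" by (simp flip: exp_add)
  have th: "tanh (x / 2) = (A - 1) / (A + 1)"
    unfolding tanh_def sinh_def cosh_def A_def ex by (simp add: exp_minus divide_simps)
  have "of_real s = Cs * (of_real A - 1) / (Sn * (of_real A + 1))"
    by (simp add: s_def th cot_def Cs_def Sn_def)
  moreover have "complex_of_real A + 1 \<noteq> 0"
    using A by (metis add_pos_pos less_irrefl of_real_1 of_real_add of_real_eq_0_iff zero_less_one)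
  ultimately have s: "of_real s * (Sn * (of_real A + 1)) = Cs * (of_real A - 1)"
    using Sn0 by simp
  have half: "exp (\<i> * of_real (2 * arctan s)) = (1 + \<i> * of_real s) / (1 - \<i> * of_real s)"
  proof -
    have n0: "sqrt (1 + s\<^sup>2) \<noteq> 0" by (metis add_pos_nonneg less_irrefl real_sqrt_eq_zero_cancel_iff zero_le_power2 zero_less_one)
    have c: "cis (arctan s) = (1 + \<i> * of_real s) / of_real (sqrt (1 + s\<^sup>2))"
      by (simp add: complex_eq_iff cos_arctan sin_arctan)
    have c': "cis (- arctan s) = (1 - \<i> * of_real s) / of_real (sqrt (1 + s\<^sup>2))"
      by (simp add: complex_eq_iff cos_arctan sin_arctan)
    have "exp (\<i> * of_real (2 * arctan s)) = cis (arctan s) / cis (- arctan s)"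
      by (simp only: cis_divide flip: cis_conv_exp) simp
    also have "\<dots> = (1 + \<i> * of_real s) / (1 - \<i> * of_real s)"
      unfolding c c' using n0 by simp
    finally show ?thesis .
  qed
  have d0: "1 - \<i> * of_real s \<noteq> 0" by (simp add: complex_eq_iff)
  have d1: "w * w * of_real A - 1 \<noteq> 0"
  proof
    assume "w * w * of_real A - 1 = 0"
    then have e: "w * w * of_real A = 1" by simp
    then have "norm (w * w * of_real A) = 1" by simp
    then have "A = 1" using A by (simp add: w_def norm_mult)
    with e have "w * w = 1" by simp
    then have "cis \<nu> = 1" by (simp add: w_def cis_mult)
    then have "cos \<nu> = 1" by (metis cis.sel(1) one_complex.sel(1))
    moreover have "cos \<nu> = 1 - 2 * (sin (\<nu> / 2))\<^sup>2"
      using cos_double_sin[of "\<nu> / 2"] by simp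
    ultimately show False using assms by simp
  qed
  have "Sn * (of_real A + 1) * ((1 + \<i> * of_real s) * (w * w * of_real A - 1)) =
        Sn * (of_real A + 1) * ((w * w - of_real A) * (1 - \<i> * of_real s))"
  proof -
    have i2: "\<i> * \<i> = -1" by simp
    define v where "v = Cs - \<i> * Sn"
    have vw: "v * w = 1" using CS i2 unfolding v_def w by algebra
    have l: "Sn * (of_real A + 1) * (1 + \<i> * of_real s) = \<i> * (of_real A * v - w)"
      using s i2 unfolding v_def w by algebra
    have r: "Sn * (of_real A + 1) * (1 - \<i> * of_real s) = - \<i> * (of_real A * w - v)"
      using s i2 unfolding v_def w by algebra
    have m: "(of_real A * v - w) * (w * w * of_real A - 1) = - (w * w - of_real A) * (of_real A * w - v)"
      using vw by algebra
    have "Sn * (of_real A + 1) * ((1 + \<i> * of_real s) * (w * w * of_real A - 1)) =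
        \<i> * ((of_real A * v - w) * (w * w * of_real A - 1))"
      unfolding mult.assoc[symmetric] l by simp
    also have "\<dots> = (w * w - of_real A) * (- \<i> * (of_real A * w - v))"
      unfolding m by (simp add: algebra_simps)
    also have "\<dots> = Sn * (of_real A + 1) * ((w * w - of_real A) * (1 - \<i> * of_real s))"
      unfolding r[symmetric] by (simp add: mult_ac)
    finally show ?thesis .
  qed
  then have "(1 + \<i> * of_real s) * (w * w * of_real A - 1) = (w * w - of_real A) * (1 - \<i> * of_real s)"
    using Sn0 \<open>complex_of_real A + 1 \<noteq> 0\<close> by simp
  then have "(1 + \<i> * of_real s) / (1 - \<i> * of_real s) = (w * w - of_real A) / (w * w * of_real A - 1)"
    using d0 d1 by (simp add: frac_eq_eq)
  moreover have "exp (complex_of_real x) = of_real A" by (simp add: A_def exp_of_real)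
  ultimately show ?thesis
    unfolding phase_def s_def[symmetric] half ww by simp
qed

section \<open>Closed forms of the momentum and of the scattering phase\<close>

lemma Delta_bounds:
  assumes "t \<in> {0<..sqrt 2}"
  shows "0 \<le> Delta t" "Delta t < 1" "t < sqrt 2 \<Longrightarrow> 0 < Delta t"
proof -
  have "t\<^sup>2 \<le> (sqrt 2)\<^sup>2" using assms by (intro power_mono) auto
  then show "0 \<le> Delta t" by (simp add: Delta_def)
  show "Delta t < 1" using assms by (simp add: Delta_def)
  assume "t < sqrt 2"
  then have "t\<^sup>2 < (sqrt 2)\<^sup>2" using assms by (intro power_strict_mono) auto
  then show "0 < Delta t" by (simp add: Delta_def)
qed

lemma mu_bounds:
  assumes "t \<in> {0<..sqrt 2}"
  shows "pi / 2 \<le> mu t" "mu t < pi" "cos (mu t) = - Delta t" "t < sqrt 2 \<Longrightarrow> pi / 2 < mu t"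
proof -
  note D = Delta_bounds[OF assms]
  have "arccos 0 \<le> arccos (- Delta t)" using D by (intro arccos_le_arccos) auto
  then show "pi / 2 \<le> mu t" by (simp add: mu_def)
  have "arccos (- Delta t) < arccos (- 1)" using D by (intro arccos_less_arccos) auto
  then show "mu t < pi" by (simp add: mu_def)
  show "cos (mu t) = - Delta t" using D by (simp add: mu_def)
  assume "t < sqrt 2"
  then have "arccos 0 < arccos (- Delta t)" using D by (intro arccos_less_arccos) auto
  then show "pi / 2 < mu t" by (simp add: mu_def)
qed

lemma arctan_cot: "0 < x \<Longrightarrow> x < pi \<Longrightarrow> arctan (cot x) = pi / 2 - x"
  using arctan_tan[of "pi / 2 - x"] by (simp add: tan_cot')

text \<open>The limits at infinity of \<open>\<kappa>\<^sub>t\<close> and \<open>\<theta>\<^sub>t\<close>. They satisfy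
  \<open>2 * mu t - pi = pi - 2 * (pi - mu t)\<close>, the relation on which the value of the total mass of the
  limiting counting function rests.\<close>

lemma rapidity_limits:
  assumes "t \<in> {0<..<sqrt 2}"
  shows "2 * arctan (cot (mu t / 2)) = pi - mu t" "2 * arctan (- cot (mu t)) = 2 * mu t - pi"
    "0 < cot (mu t / 2)" "0 < - cot (mu t)"
proof -
  have m: "pi / 2 < mu t" "mu t < pi" using mu_bounds[of t] assms by auto
  show 1: "2 * arctan (cot (mu t / 2)) = pi - mu t"
    using m arctan_cot[of "mu t / 2"] by simp
  show 2: "2 * arctan (- cot (mu t)) = 2 * mu t - pi"
    using m arctan_cot[of "mu t"] by (simp add: arctan_minus)
  show "0 < cot (mu t / 2)"
    using 1 m zero_less_arctan_iff[of "cot (mu t / 2)"] by linarith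
  show "0 < - cot (mu t)"
    using 2 m zero_less_arctan_iff[of "- cot (mu t)"] by linarith
qed

lemma kappa_eq_phase:
  assumes "is_kappa \<kappa>" and t: "t \<in> {0<..<sqrt 2}"
  shows "\<kappa> t \<alpha> = phase (cot (mu t / 2)) \<alpha>"
proof -
  \<comment> \<open>The normalisation is given only at \<open>(sqrt 2 / 2, 0)\<close>, so \<open>t\<close> has to vary as well.\<close>
  define S where "S = {0<..<sqrt 2} \<times> (UNIV :: real set)"
  have mu: "pi / 2 < mu s" "mu s < pi" if "s \<in> {0<..<sqrt 2}" for s
    using mu_bounds[of s] that by auto
  have sin: "sin (mu s / 2) \<noteq> 0" if "s \<in> {0<..<sqrt 2}" for s
    using sin_gt_zero[of "mu s / 2"] mu[OF that] by auto
  have "(\<lambda>(s, \<alpha>). \<kappa> s \<alpha>) (t, \<alpha>) = (\<lambda>(s, \<alpha>). phase (cot (mu s / 2)) \<alpha>) (t, \<alpha>)"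
  proof (rule exp_i_eq_imp_eq_on_connected[of S _ _ "(sqrt 2 / 2, 0)"])
    show "connected S" unfolding S_def by (intro convex_connected convex_Times) auto
    show "continuous_on S (\<lambda>(s, \<alpha>). \<kappa> s \<alpha>)"
      using assms(1) unfolding is_kappa_def S_def by (intro real_analytic_on_imp_continuous_on) auto
    have "continuous_on S (\<lambda>z. arccos (- ((2 - (fst z)\<^sup>2) / 2)))"
      using Delta_bounds by (intro continuous_intros) (force simp: S_def Delta_def)+
    then have "continuous_on S (\<lambda>z. mu (fst z))" by (simp add: mu_def Delta_def)
    then have "continuous_on S (\<lambda>z. phase (cos (mu (fst z) / 2) / sin (mu (fst z) / 2)) (snd z))"
      using sin by (intro continuous_intros) (auto simp: S_def)
    then show "continuous_on S (\<lambda>(s, \<alpha>). phase (cot (mu s / 2)) \<alpha>)"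
      by (simp add: cot_def split_def)
    have "0 < sqrt 2 / 2" "sqrt 2 / 2 < sqrt (2::real)" by auto
    then show "(sqrt 2 / 2, 0) \<in> S" unfolding S_def by auto
    show "(t, \<alpha>) \<in> S" using t by (simp add: S_def)
    fix z assume z: "z \<in> S"
    obtain s \<beta> where [simp]: "z = (s, \<beta>)" by (cases z)
    have s: "s \<in> {0<..<sqrt 2}" using z by (simp add: S_def)
    show "exp (\<i> * of_real ((\<lambda>(s, \<alpha>). \<kappa> s \<alpha>) z)) =
        exp (\<i> * of_real ((\<lambda>(s, \<alpha>). phase (cot (mu s / 2)) \<alpha>) z))"
      using assms(1) exp_i_phase[OF sin[OF s]] s unfolding is_kappa_def by (simp add: exp_add)
  qed (use assms(1) in \<open>simp add: is_kappa_def\<close>)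
  then show ?thesis by simp
qed

lemma kappa_in_I_set:
  assumes "is_kappa \<kappa>" and t: "t \<in> {0<..<sqrt 2}"
  shows "\<kappa> t \<alpha> \<in> I_set t"
  using phase_less[OF rapidity_limits(3)[OF t], of \<alpha>] phase_less[OF rapidity_limits(3)[OF t], of "- \<alpha>"]
  unfolding kappa_eq_phase[OF assms] I_set_def rapidity_limits(1)[OF t] by (simp add: phase_minus)

lemma Theta_0_0:
  assumes Th: "is_Theta \<Theta>" and t: "t \<in> {0<..sqrt 2}"
  shows "\<Theta> t 0 0 = 0"
proof -
  define S where "S = {(t, x, y). t \<in> {0<..sqrt 2} \<and> x \<in> I_set t \<and> y \<in> I_set t}"
  have I0: "0 \<in> I_set s" if "s \<in> {0<..sqrt 2}" for s
    using mu_bounds[OF that] by (simp add: I_set_def)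
  have c: "continuous_on S (\<lambda>(t, x, y). \<Theta> t x y)"
    using Th unfolding is_Theta_def S_def by (intro real_analytic_on_imp_continuous_on) auto
  show ?thesis
  proof (rule exp_i_eq_imp_eq_on_connected[of "{0<..sqrt 2}" "\<lambda>t. \<Theta> t 0 0" "\<lambda>_. 0" "sqrt 2"])
    show "connected {0<..sqrt 2}" by simp
    have "continuous_on {0<..sqrt 2} (\<lambda>t. (\<lambda>(t, x, y). \<Theta> t x y) (t, 0, 0))"
      by (rule continuous_on_compose2[OF c]) (use I0 in \<open>auto simp: S_def intro!: continuous_intros\<close>)
    then show "continuous_on {0<..sqrt 2} (\<lambda>t. \<Theta> t 0 0)" by simp
    fix s assume s: "s \<in> {0<..sqrt 2}"
    have "complex_of_real (Delta s) \<noteq> 1" using Delta_bounds(2)[OF s] by auto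
    then have "exp (- \<i> * of_real (\<Theta> s 0 0)) = 1"
      using Th s I0[OF s] unfolding is_Theta_def by simp
    then have "inverse (exp (\<i> * of_real (\<Theta> s 0 0))) = 1" by (simp add: exp_minus)
    then show "exp (\<i> * of_real (\<Theta> s 0 0)) = exp (\<i> * of_real 0)" by simp
  qed (use Th t in \<open>auto simp: is_Theta_def\<close>)
qed

text \<open>In the rapidity variables the scattering phase depends only on the difference of its
  arguments. Since \<open>mu t\<close> lies strictly between \<open>pi / 2\<close> and \<open>pi\<close>, the parameter \<open>- cot (mu t)\<close> is
  positive, so \<^term>\<open>theta \<Theta> \<kappa> t\<close> increases in its first argument.\<close>

lemma theta_eq_phase:
  assumes Th: "is_Theta \<Theta>" and ka: "is_kappa \<kappa>" and t: "t \<in> {0<..<sqrt 2}"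
  shows "theta \<Theta> \<kappa> t \<alpha> \<beta> = phase (- cot (mu t)) (\<alpha> - \<beta>)"
proof -
  define S where "S = {(t, x, y). t \<in> {0<..sqrt 2} \<and> x \<in> I_set t \<and> y \<in> I_set t}"
  have mu: "pi / 2 < mu t" "mu t < pi" "cos (mu t) = - Delta t"
    using mu_bounds[of t] t by auto
  have sin: "sin (mu t) \<noteq> 0" using sin_gt_zero[of "mu t"] mu by auto
  have sin2: "sin (mu t / 2) \<noteq> 0" using sin_gt_zero[of "mu t / 2"] mu by auto
  have c: "continuous_on S (\<lambda>(t, x, y). \<Theta> t x y)"
    using Th unfolding is_Theta_def S_def by (intro real_analytic_on_imp_continuous_on) auto
  have K: "\<kappa> t = phase (cot (mu t / 2))" using kappa_eq_phase[OF ka t] by auto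
  have "(\<lambda>(\<alpha>, \<beta>). - \<Theta> t (\<kappa> t \<alpha>) (\<kappa> t \<beta>)) (\<alpha>, \<beta>)
      = (\<lambda>(\<alpha>, \<beta>). phase (cot (mu t)) (\<alpha> - \<beta>)) (\<alpha>, \<beta>)"
  proof (rule exp_i_eq_imp_eq_on_connected[of UNIV _ _ "(0, 0)"])
    show "connected (UNIV :: (real \<times> real) set)" by (intro convex_connected convex_UNIV)
    have "continuous_on UNIV (\<lambda>z. (t, \<kappa> t (fst z), \<kappa> t (snd z)))"
      unfolding K by (intro continuous_intros)
    then have "continuous_on UNIV (\<lambda>z. (\<lambda>(t, x, y). \<Theta> t x y) (t, \<kappa> t (fst z), \<kappa> t (snd z)))"
      by (rule continuous_on_compose2[OF c]) (use t kappa_in_I_set[OF ka t] in \<open>auto simp: S_def\<close>)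
    then have "continuous_on UNIV (\<lambda>z. \<Theta> t (\<kappa> t (fst z)) (\<kappa> t (snd z)))" by simp
    then show "continuous_on UNIV (\<lambda>(\<alpha>, \<beta>). - \<Theta> t (\<kappa> t \<alpha>) (\<kappa> t \<beta>))"
      by (simp add: split_def continuous_on_minus)
    show "continuous_on UNIV (\<lambda>(\<alpha>, \<beta>). phase (cot (mu t)) (\<alpha> - \<beta>))"
      unfolding split_def by (intro continuous_intros)
    show "(\<lambda>(\<alpha>, \<beta>). - \<Theta> t (\<kappa> t \<alpha>) (\<kappa> t \<beta>)) (0, 0) = (\<lambda>(\<alpha>, \<beta>). phase (cot (mu t)) (\<alpha> - \<beta>)) (0, 0)"
      using Theta_0_0[OF Th, of t] t by (simp add: K)
    fix r :: "real \<times> real"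
    obtain \<alpha> \<beta> where [simp]: "r = (\<alpha>, \<beta>)" by (cases r)
    define z where "z = exp (\<i> * of_real (\<kappa> t \<alpha>))"
    define w where "w = exp (\<i> * of_real (\<kappa> t \<beta>))"
    define q where "q = exp (\<i> * of_real (mu t))"
    define u where "u = exp (- \<i> * of_real (mu t))"
    define A where "A = complex_of_real (exp \<alpha>)"
    define B where "B = complex_of_real (exp \<beta>)"
    have qu: "q * u = 1" by (simp add: q_def u_def flip: exp_add)
    have nz: "z \<noteq> 0" "w \<noteq> 0" "q \<noteq> 0" "u \<noteq> 0" "A \<noteq> 0" "B \<noteq> 0"
      by (simp_all add: z_def w_def q_def u_def A_def B_def)
    have D: "2 * complex_of_real (Delta t) = - (q + u)"
    proof -
      have "q + u = complex_of_real (2 * cos (mu t))"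
        using cis_conv_exp[of "mu t"] cis_conv_exp[of "- mu t"]
        by (simp add: q_def u_def complex_eq_iff)
      then show ?thesis using mu(3) by simp
    qed
    have z: "z = (q - A) / (q * A - 1)" and w: "w = (q - B) / (q * B - 1)"
      using exp_i_phase[OF sin2] unfolding z_def w_def K q_def A_def B_def by (simp_all add: exp_of_real)
    have P: "q * A - 1 \<noteq> 0" and Q: "q * B - 1 \<noteq> 0" using z w nz(1,2) by auto
    have z': "z * (q * A - 1) = q - A" and w': "w * (q * B - 1) = q - B"
      using z w P Q by simp_all
    have q2: "q * q - 1 \<noteq> 0"
    proof
      assume "q * q - 1 = 0"
      then have "cis (2 * mu t) = 1"
        by (simp add: q_def cis_mult flip: cis_conv_exp)
      then have "cos (2 * mu t) = 1" by (metis cis.sel(1) one_complex.sel(1))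
      then show False using sin cos_double_sin[of "mu t"] by simp
    qed
    \<comment> \<open>With \<open>2 * Delta t = - (q + u)\<close>, numerator and denominator factor in the rapidities.\<close>
    have num: "(q * A - 1) * (q * B - 1) * (1 + z * w + (q + u) * z) = (q * q - 1) * u * (q * q * B - A)"
      using z' w' qu by algebra
    have den: "(q * A - 1) * (q * B - 1) * (1 + z * w + (q + u) * w) = (q * q - 1) * u * (q * q * A - B)"
      using z' w' qu by algebra
    have "exp (\<i> * of_real (- \<Theta> t (\<kappa> t \<alpha>) (\<kappa> t \<beta>))) =
        exp (\<i> * of_real (\<kappa> t \<alpha> - \<kappa> t \<beta>)) *
        ((exp (- \<i> * of_real (\<kappa> t \<alpha>)) + exp (\<i> * of_real (\<kappa> t \<beta>)) - 2 * of_real (Delta t)) /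
         (exp (- \<i> * of_real (\<kappa> t \<beta>)) + exp (\<i> * of_real (\<kappa> t \<alpha>)) - 2 * of_real (Delta t)))"
      using Th t kappa_in_I_set[OF ka t] unfolding is_Theta_def by simp
    also have "\<dots> = z / w * ((1 / z + w + (q + u)) / (1 / w + z + (q + u)))"
    proof -
      have "exp (\<i> * of_real (\<kappa> t \<alpha> - \<kappa> t \<beta>)) = z / w"
        by (simp add: z_def w_def right_diff_distrib exp_diff)
      moreover have "exp (- \<i> * of_real (\<kappa> t \<alpha>)) = 1 / z" "exp (- \<i> * of_real (\<kappa> t \<beta>)) = 1 / w"
        by (simp_all add: z_def w_def exp_minus inverse_eq_divide)
      ultimately show ?thesis unfolding D diff_minus_eq_add z_def[symmetric] w_def[symmetric] by simp
    qed
    also have "1 / z + w + (q + u) = (1 + z * w + (q + u) * z) / z" using nz by (simp add: field_simps)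
    also have "1 / w + z + (q + u) = (1 + z * w + (q + u) * w) / w" using nz by (simp add: field_simps)
    also have "z / w * ((1 + z * w + (q + u) * z) / z / ((1 + z * w + (q + u) * w) / w)) =
        (1 + z * w + (q + u) * z) / (1 + z * w + (q + u) * w)" using nz by simp
    also have "\<dots> = ((q * A - 1) * (q * B - 1) * (1 + z * w + (q + u) * z)) /
        ((q * A - 1) * (q * B - 1) * (1 + z * w + (q + u) * w))" using P Q by simp
    also have "\<dots> = (q * q * B - A) / (q * q * A - B)" unfolding num den using q2 nz by simp
    also have "\<dots> = (q * q - A / B) / (q * q * (A / B) - 1)" using nz by (simp add: divide_simps)
    also have "\<dots> = exp (\<i> * of_real (phase (cot (mu t)) (\<alpha> - \<beta>)))"
    proof -
      have "exp (\<i> * of_real (2 * mu t)) = q * q"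
        by (simp add: q_def algebra_simps flip: exp_add)
      moreover have "exp (complex_of_real (\<alpha> - \<beta>)) = A / B"
        by (simp add: A_def B_def exp_of_real exp_diff)
      ultimately show ?thesis using exp_i_phase[of "2 * mu t" "\<alpha> - \<beta>"] sin by simp
    qed
    finally show "exp (\<i> * of_real ((\<lambda>(\<alpha>, \<beta>). - \<Theta> t (\<kappa> t \<alpha>) (\<kappa> t \<beta>)) r)) =
        exp (\<i> * of_real ((\<lambda>(\<alpha>, \<beta>). phase (cot (mu t)) (\<alpha> - \<beta>)) r))" by simp
  qed auto
  then show ?thesis by (simp add: theta_def phase_minus_left)
qed

section \<open>Finite systems of Bethe equations\<close>

text \<open>The counting function of rapidities \<open>a 1, \<dots>, a n\<close>, with \<^term>\<open>phase b\<close> for the momentum and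
  \<^term>\<open>phase c\<close> of the difference for the scattering phase.\<close>

definition counting :: "real \<Rightarrow> real \<Rightarrow> nat \<Rightarrow> nat \<Rightarrow> (nat \<Rightarrow> real) \<Rightarrow> real \<Rightarrow> real" where
  "counting b c N n a x =
    phase b x / (2 * pi) + (real n + 1) / (2 * real N) + (\<Sum>j=1..n. phase c (x - a j)) / (2 * pi * real N)"

text \<open>The derivative of the counting function.\<close>

definition counting' :: "real \<Rightarrow> real \<Rightarrow> nat \<Rightarrow> nat \<Rightarrow> (nat \<Rightarrow> real) \<Rightarrow> real \<Rightarrow> real" where
  "counting' b c N n a x = phase' b x / (2 * pi) + (\<Sum>j=1..n. phase' c (x - a j)) / (2 * pi * real N)"

text \<open>The Bethe equations in the rapidity variables. Positivity of \<open>b\<close> and \<open>c\<close> makes both phases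
  increasing.\<close>

locale bethe_system =
  fixes b c :: real and N n :: nat and a :: "nat \<Rightarrow> real"
  assumes b_pos: "0 < b" and c_pos: "0 < c" and N_pos: "0 < N"
    and bethe: "\<And>j. j \<in> {1..n} \<Longrightarrow>
      real N * phase b (a j) + (\<Sum>l=1..n. phase c (a j - a l)) = 2 * pi * real j - (real n + 1) * pi"

text \<open>A maximum principle: where the difference of two solutions is largest, every scattering term
  of the first dominates that of the second, so its momentum is at most that of the second. By
  symmetry the solution is unique.\<close>

lemma bethe_system_le:
  assumes "bethe_system b c N n a" "bethe_system b c N n a'" and i: "i \<in> {1..n}"
  shows "a i \<le> a' i"
proof -
  interpret A: bethe_system b c N n a by fact
  interpret A': bethe_system b c N n a' by fact
  define m where "m = Max ((\<lambda>j. a j - a' j) ` {1..n})"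
  have "m \<in> (\<lambda>j. a j - a' j) ` {1..n}" unfolding m_def using i by (intro Max_in) auto
  then obtain j where j: "j \<in> {1..n}" "m = a j - a' j" by blast
  have max: "a l - a' l \<le> a j - a' j" if "l \<in> {1..n}" for l
    unfolding j(2)[symmetric] m_def using that by (intro Max_ge) auto
  have "(\<Sum>l=1..n. phase c (a' j - a' l)) \<le> (\<Sum>l=1..n. phase c (a j - a l))"
    using max by (intro sum_mono phase_mono A.c_pos) (simp add: algebra_simps)
  then have "real N * phase b (a j) \<le> real N * phase b (a' j)"
    using A.bethe[OF j(1)] A'.bethe[OF j(1)] by linarith
  then have "phase b (a j) \<le> phase b (a' j)" using A.N_pos by simp
  then have "a j \<le> a' j" using phase_strict_mono[OF A.b_pos, of "a' j" "a j"] by linarith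
  then show ?thesis using max[OF i] by linarith
qed

context bethe_system
begin

abbreviation Xi :: "real \<Rightarrow> real" where "Xi \<equiv> counting b c N n a"

lemma sum_reflect: "(\<Sum>l=1..n. g (n + 1 - l)) = (\<Sum>l=1..n. g l)" for g :: "nat \<Rightarrow> real"
  by (rule sum.reindex_bij_witness[of _ "\<lambda>l. n + 1 - l" "\<lambda>l. n + 1 - l"]) auto

text \<open>Negating and reversing a solution gives a solution, so by uniqueness the roots are symmetric
  about \<open>0\<close>.\<close>

lemma bethe_system_reflect: "bethe_system b c N n (\<lambda>j. - a (n + 1 - j))"
proof
  fix j assume j: "j \<in> {1..n}"
  have "(\<Sum>l=1..n. phase c (- a (n + 1 - j) - - a (n + 1 - l)))
      = (\<Sum>l=1..n. - phase c (a (n + 1 - j) - a (n + 1 - l)))"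
    by (intro sum.cong refl) (simp flip: phase_minus)
  also have "\<dots> = - (\<Sum>l=1..n. phase c (a (n + 1 - j) - a l))"
    unfolding sum_negf sum_reflect[of "\<lambda>l. phase c (a (n + 1 - j) - a l)"] ..
  finally have sum: "(\<Sum>l=1..n. phase c (- a (n + 1 - j) - - a (n + 1 - l)))
      = - (\<Sum>l=1..n. phase c (a (n + 1 - j) - a l))" .
  have j': "n + 1 - j \<in> {1..n}" "real (n + 1 - j) = real n + 1 - real j" using j by (auto simp: of_nat_diff)
  show "real N * phase b (- a (n + 1 - j)) + (\<Sum>l=1..n. phase c (- a (n + 1 - j) - - a (n + 1 - l)))
      = 2 * pi * real j - (real n + 1) * pi"
    using bethe[OF j'(1)] unfolding sum j'(2) phase_minus by (simp add: algebra_simps)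
qed (fact b_pos c_pos N_pos)+

lemma root_reflect: "j \<in> {1..n} \<Longrightarrow> a (n + 1 - j) = - a j"
  using bethe_system_le[OF bethe_system_axioms bethe_system_reflect, of j]
    bethe_system_le[OF bethe_system_reflect bethe_system_axioms, of j] by simp

lemma Xi_root:
  assumes "j \<in> {1..n}"
  shows "Xi (a j) = real j / real N"
proof -
  have "2 * pi * real N * Xi (a j) =
      real N * phase b (a j) + (real n + 1) * pi + (\<Sum>l=1..n. phase c (a j - a l))"
    using N_pos by (simp add: counting_def field_simps)
  also have "\<dots> = 2 * pi * real j" using bethe[OF assms] by simp
  finally show ?thesis using N_pos by (simp add: field_simps)
qed

lemma Xi_diff_ge:
  assumes "x \<le> y"
  shows "(phase b y - phase b x) / (2 * pi) \<le> Xi y - Xi x"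
proof -
  have "(\<Sum>j=1..n. phase c (x - a j)) / (2 * pi * real N) \<le> (\<Sum>j=1..n. phase c (y - a j)) / (2 * pi * real N)"
    using assms by (intro divide_right_mono sum_mono phase_mono c_pos) auto
  then show ?thesis by (simp add: counting_def diff_divide_distrib)
qed

lemma Xi_strict_mono: "x < y \<Longrightarrow> Xi x < Xi y"
  using Xi_diff_ge[of x y] phase_strict_mono[OF b_pos, of x y]
  by (smt (verit) divide_pos_pos pi_gt_zero)

lemma Xi_less_iff: "Xi x < Xi y \<longleftrightarrow> x < y"
  using Xi_strict_mono by (metis linorder_neqE_linordered_idom order_less_asym)

lemma sum_phase_minus: "(\<Sum>j=1..n. phase c (- x - a j)) = - (\<Sum>j=1..n. phase c (x - a j))"
proof -
  have "(\<Sum>j=1..n. phase c (- x - a j)) = (\<Sum>j=1..n. phase c (- x - a (n + 1 - j)))"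
    by (rule sum_reflect[symmetric])
  also have "\<dots> = (\<Sum>j=1..n. - phase c (x - a j))"
    using root_reflect by (intro sum.cong refl) (simp flip: phase_minus)
  finally show ?thesis by (simp add: sum_negf)
qed

lemma Xi_0: "Xi 0 = (real n + 1) / (2 * real N)"
  using sum_phase_minus[of 0] by (simp add: counting_def)

lemma has_real_derivative_Xi: "(Xi has_real_derivative counting' b c N n a x) (at x)"
proof -
  have "((\<lambda>x. phase c (x - a j)) has_real_derivative phase' c (x - a j)) (at x)" for j
  proof -
    have "((\<lambda>x. phase c (x - a j)) has_real_derivative phase' c (x - a j) * 1) (at x)"
      by (rule DERIV_chain2[OF has_real_derivative_phase]) (auto intro!: derivative_eq_intros)
    then show ?thesis by simp
  qed
  then have "((\<lambda>x. phase b x / (2 * pi) + (real n + 1) / (2 * real N) +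
      (\<Sum>j=1..n. phase c (x - a j)) / (2 * pi * real N)) has_real_derivative
      phase' b x / (2 * pi) + 0 + (\<Sum>j=1..n. phase' c (x - a j)) / (2 * pi * real N)) (at x)"
    by (intro DERIV_add DERIV_cdivide DERIV_const DERIV_sum has_real_derivative_phase)
  then show ?thesis by (simp add: counting_def[abs_def] counting'_def)
qed

lemma Xi'_bounds:
  shows "0 \<le> counting' b c N n a x"
    and "counting' b c N n a x \<le> (b + real n / real N * c) / (2 * pi)"
proof -
  note pb = phase'_bounds[OF less_imp_le[OF b_pos]] and pc = phase'_bounds[OF less_imp_le[OF c_pos]]
  show "0 \<le> counting' b c N n a x"
    unfolding counting'_def by (intro add_nonneg_nonneg divide_nonneg_nonneg sum_nonneg pb pc) auto
  have "(\<Sum>j=1..n. phase' c (x - a j)) \<le> (\<Sum>j=1..n. c)" by (intro sum_mono pc)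
  then have "(\<Sum>j=1..n. phase' c (x - a j)) / (2 * pi * real N) \<le> (real n * c) / (2 * pi * real N)"
    by (intro divide_right_mono) auto
  moreover have "phase' b x / (2 * pi) \<le> b / (2 * pi)" by (intro divide_right_mono pb) auto
  ultimately show "counting' b c N n a x \<le> (b + real n / real N * c) / (2 * pi)"
    by (simp add: counting'_def add_divide_distrib mult_ac)
qed

lemma Xi'_Lipschitz:
  "\<bar>counting' b c N n a x - counting' b c N n a y\<bar>
    \<le> (b * (1 + b\<^sup>2) + real n / real N * (c * (1 + c\<^sup>2))) / (2 * pi) * \<bar>x - y\<bar>"
proof -
  have "\<bar>(\<Sum>j=1..n. phase' c (x - a j)) - (\<Sum>j=1..n. phase' c (y - a j))\<bar>
      \<le> (\<Sum>j=1..n. \<bar>phase' c (x - a j) - phase' c (y - a j)\<bar>)"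
    unfolding sum_subtractf[symmetric] by (rule sum_abs)
  also have "\<dots> \<le> (\<Sum>j=1..n. c * (1 + c\<^sup>2) * \<bar>x - y\<bar>)"
    using phase'_Lipschitz[OF less_imp_le[OF c_pos]] by (intro sum_mono) (metis diff_diff_eq2 diff_add_cancel)
  finally have S: "\<bar>(\<Sum>j=1..n. phase' c (x - a j)) - (\<Sum>j=1..n. phase' c (y - a j))\<bar>
      \<le> real n * (c * (1 + c\<^sup>2) * \<bar>x - y\<bar>)" by simp
  have "\<bar>counting' b c N n a x - counting' b c N n a y\<bar> =
      \<bar>(phase' b x - phase' b y) / (2 * pi) +
       ((\<Sum>j=1..n. phase' c (x - a j)) - (\<Sum>j=1..n. phase' c (y - a j))) / (2 * pi * real N)\<bar>"
    by (simp add: counting'_def diff_divide_distrib)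
  also have "\<dots> \<le> \<bar>(phase' b x - phase' b y) / (2 * pi)\<bar> +
       \<bar>((\<Sum>j=1..n. phase' c (x - a j)) - (\<Sum>j=1..n. phase' c (y - a j))) / (2 * pi * real N)\<bar>"
    by (rule abs_triangle_ineq)
  also have "\<dots> = \<bar>phase' b x - phase' b y\<bar> / (2 * pi) +
       \<bar>(\<Sum>j=1..n. phase' c (x - a j)) - (\<Sum>j=1..n. phase' c (y - a j))\<bar> / (2 * pi * real N)"
    by (simp add: abs_mult)
  also have "\<dots> \<le> b * (1 + b\<^sup>2) * \<bar>x - y\<bar> / (2 * pi) + real n * (c * (1 + c\<^sup>2) * \<bar>x - y\<bar>) / (2 * pi * real N)"
    using phase'_Lipschitz[OF less_imp_le[OF b_pos], of x y] S
    by (intro add_mono divide_right_mono) auto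
  also have "\<dots> = (b * (1 + b\<^sup>2) + real n / real N * (c * (1 + c\<^sup>2))) / (2 * pi) * \<bar>x - y\<bar>"
    by (simp add: add_divide_distrib distrib_right distrib_left mult_ac)
  finally show ?thesis .
qed

lemma Xi_upper:
  "Xi x \<le> 2 * arctan b / (2 * pi) + (real n + 1) / (2 * real N) + real n / real N * (2 * arctan c / (2 * pi))"
proof -
  have "(\<Sum>j=1..n. phase c (x - a j)) \<le> (\<Sum>j=1..n. 2 * arctan c)"
    by (intro sum_mono less_imp_le phase_less c_pos)
  then have "(\<Sum>j=1..n. phase c (x - a j)) / (2 * pi * real N) \<le> (real n * (2 * arctan c)) / (2 * pi * real N)"
    by (intro divide_right_mono) auto
  moreover have "phase b x / (2 * pi) \<le> 2 * arctan b / (2 * pi)"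
    using phase_less[OF b_pos, of x] by (intro divide_right_mono) auto
  ultimately show ?thesis by (simp add: counting_def mult_ac)
qed

text \<open>At \<open>x \<ge> 0\<close> the scattering terms of \<open>a j\<close> and of its mirror root \<open>- a j\<close> have a nonnegative
  sum, however far out these roots are, and a sum of at least \<open>2 * phase c (x - R)\<close> if they lie in
  \<open>[- R, R]\<close>. The number of roots in \<open>[- R, R]\<close> is read off from \<open>Xi R\<close>, up to rounding.\<close>

lemma Xi_lower:
  assumes R: "0 \<le> R" "R \<le> x" and small: "Xi R < (real n + 1) / real N"
  shows "phase b x / (2 * pi) + (real n + 1) / (2 * real N)
    + (2 * Xi R - (real n + 2) / real N) * phase c (x - R) / (2 * pi) \<le> Xi x"
proof -
  define u where "u = nat \<lfloor>real N * Xi R\<rfloor>"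
  have Xi_R: "0 < Xi R"
    using Xi_0 Xi_diff_ge[of 0 R] phase_mono[OF b_pos, of 0 R] R N_pos
    by (smt (verit) divide_nonneg_pos divide_pos_pos of_nat_0_less_iff of_nat_0_le_iff pi_gt_zero)
  then have u: "real u \<le> real N * Xi R" "real N * Xi R < real u + 1"
    unfolding u_def using N_pos by (auto simp: of_nat_floor) (linarith+)?
  have "real N * Xi R < real n + 1" using small N_pos by (simp add: field_simps)
  then have un: "u \<le> n" using u(1) by linarith
  \<comment> \<open>These are the indices of the roots in \<open>[- R, R]\<close>.\<close>
  define J where "J = {n + 1 - u..u}"
  have J: "J \<subseteq> {1..n}" using un by (auto simp: J_def)
  have le_R: "a j \<le> R" if "j \<in> J" for j
  proof -
    have "real j \<le> real N * Xi R" using that u by (auto simp: J_def)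
    then have "real j / real N \<le> Xi R" using N_pos by (simp add: divide_le_eq mult.commute)
    then have "Xi (a j) \<le> Xi R" using Xi_root[of j] that J by auto
    then show ?thesis using Xi_less_iff[of R "a j"] by linarith
  qed
  have abs_le_R: "a j \<le> R" "- R \<le> a j" if "j \<in> J" for j
  proof -
    have "n + 1 - j \<in> J" "j \<in> {1..n}" using that un by (auto simp: J_def)
    then show "a j \<le> R" "- R \<le> a j" using le_R[of j] le_R[of "n + 1 - j"] root_reflect[of j] that by auto
  qed
  define g where "g j = phase c (x - a j) + phase c (x + a j)" for j
  have g0: "0 \<le> g j" for j
    using phase_mono[OF c_pos, of "a j - x" "x + a j"] R phase_minus[of c "a j - x"] by (simp add: g_def)
  have gR: "2 * phase c (x - R) \<le> g j" if "j \<in> J" for j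
    using phase_mono[OF c_pos, of "x - R" "x + a j"] phase_mono[OF c_pos, of "x - R" "x - a j"] abs_le_R[OF that]
    by (simp add: g_def)
  have pos: "0 \<le> phase c (x - R)" using phase_mono[OF c_pos, of 0 "x - R"] R by simp
  have "(\<Sum>j=1..n. phase c (- x - a j)) = (\<Sum>j=1..n. - phase c (x + a j))"
    using phase_minus[of c "x + a _"] by (intro sum.cong refl) (simp add: algebra_simps)
  then have "(\<Sum>j=1..n. phase c (x + a j)) = (\<Sum>j=1..n. phase c (x - a j))"
    using sum_phase_minus[of x] by (simp add: sum_negf)
  then have "2 * (\<Sum>j=1..n. phase c (x - a j)) = (\<Sum>j=1..n. g j)"
    by (simp add: g_def sum.distrib)
  also have "\<dots> \<ge> (\<Sum>j\<in>J. g j)"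
    using J g0 by (intro sum_mono2) auto
  also have "(\<Sum>j\<in>J. g j) \<ge> (\<Sum>j\<in>J. 2 * phase c (x - R))" by (intro sum_mono gR)
  finally have "real (card J) * phase c (x - R) \<le> (\<Sum>j=1..n. phase c (x - a j))" by simp
  moreover have "(2 * (real N * Xi R) - real n - 2) * phase c (x - R) \<le> real (card J) * phase c (x - R)"
    using u un by (intro mult_right_mono pos) (simp add: J_def of_nat_diff)
  ultimately have "(2 * (real N * Xi R) - real n - 2) * phase c (x - R) / (2 * pi * real N)
      \<le> (\<Sum>j=1..n. phase c (x - a j)) / (2 * pi * real N)"
    by (intro divide_right_mono) auto
  moreover have "(2 * (real N * Xi R) - real n - 2) * phase c (x - R) / (2 * pi * real N) =
      (2 * Xi R - (real n + 2) / real N) * phase c (x - R) / (2 * pi)"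
    using N_pos by (simp add: field_simps)
  ultimately show ?thesis by (simp add: counting_def)
qed

text \<open>The roots counted from the middle are positive and, the slope of \<open>Xi\<close> being at most \<open>C\<close>, grow
  at least linearly in their number. This controls \<open>f\<close> at the roots close to \<open>0\<close>, where \<open>f\<close> may be
  unbounded.\<close>

lemma upper_half_root:
  assumes C: "\<And>x. counting' b c N n a x \<le> C" and i: "1 \<le> i" "nat \<lceil>real n / 2\<rceil> + i \<le> n"
  shows "0 < a (nat \<lceil>real n / 2\<rceil> + i)" "real i / (2 * real N) \<le> C * a (nat \<lceil>real n / 2\<rceil> + i)"
proof -
  define j where "j = nat \<lceil>real n / 2\<rceil> + i"
  have j: "j \<in> {1..n}" "real j \<ge> real n / 2 + real i"
    using i by (auto simp: j_def real_nat_ceiling_ge)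
  have "Xi 0 < Xi (a j)" unfolding Xi_0 Xi_root[OF j(1)]
  proof -
    have "(real n + 1) / 2 < real j" using j i by simp
    then have "(real n + 1) / 2 / real N < real j / real N" using N_pos by (intro divide_strict_right_mono) auto
    then show "(real n + 1) / (2 * real N) < real j / real N" by simp
  qed
  then have pos: "0 < a j" by (simp add: Xi_less_iff)
  then show "0 < a (nat \<lceil>real n / 2\<rceil> + i)" by (simp add: j_def)
  obtain z where "Xi (a j) - Xi 0 = (a j - 0) * counting' b c N n a z"
    using MVT2[OF pos, of Xi "counting' b c N n a"] has_real_derivative_Xi by blast
  also have "\<dots> \<le> a j * C" using C pos by (simp add: mult_left_mono)
  finally have "(real j - (real n + 1) / 2) / real N \<le> C * a j"
    unfolding Xi_0 Xi_root[OF j(1)] by (simp add: diff_divide_distrib mult.commute)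
  \<comment> \<open>The half-integer shift costs at most half of the index: \<open>j - (n + 1) / 2 \<ge> i - 1 / 2 \<ge> i / 2\<close>.\<close>
  moreover have "(real i / 2) / real N \<le> (real j - (real n + 1) / 2) / real N"
  proof (rule divide_right_mono)
    have "1 \<le> real i" using i by simp
    then show "real i / 2 \<le> real j - (real n + 1) / 2" using j(2) by argo
  qed simp
  ultimately show "real i / (2 * real N) \<le> C * a (nat \<lceil>real n / 2\<rceil> + i)" by (simp add: j_def)
qed

end

section \<open>The limiting counting function\<close>

lemma derivative_of_limit_Lipschitz:
  fixes F G :: "nat \<Rightarrow> real \<Rightarrow> real"
  assumes der: "\<And>k x. (F k has_real_derivative G k x) (at x)"
    and lip: "\<And>k x y. \<bar>G k x - G k y\<bar> \<le> M * \<bar>x - y\<bar>"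
    and lim: "\<And>x. (\<lambda>k. F k x) \<longlonglongrightarrow> \<xi> x"
  obtains g where "\<And>x. (\<xi> has_real_derivative g x) (at x)" "\<And>x. (\<lambda>k. G k x) \<longlonglongrightarrow> g x"
    "\<And>x y. \<bar>g x - g y\<bar> \<le> M * \<bar>x - y\<bar>"
proof -
  have M: "0 \<le> M" using lip[of 0 0 1] by simp
  have taylor: "\<bar>F k (x + h) - F k x - h * G k x\<bar> \<le> M * \<bar>h\<bar> * \<bar>h\<bar>" for k x h
  proof -
    define S where "S = {x - \<bar>h\<bar>..x + \<bar>h\<bar>}"
    have "norm ((\<lambda>y. F k y - y * G k x) (x + h) - (\<lambda>y. F k y - y * G k x) x) \<le> (M * \<bar>h\<bar>) * norm (x + h - x)"
    proof (rule field_differentiable_bound[of S _ "\<lambda>y. G k y - G k x"])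
      fix y assume y: "y \<in> S"
      have "((\<lambda>y. F k y - y * G k x) has_real_derivative G k y - G k x) (at y)"
        using der by (auto intro!: derivative_eq_intros)
      then show "((\<lambda>y. F k y - y * G k x) has_real_derivative G k y - G k x) (at y within S)"
        by (rule has_field_derivative_at_within)
      have "M * \<bar>y - x\<bar> \<le> M * \<bar>h\<bar>" using y M by (intro mult_left_mono) (auto simp: S_def)
      then show "norm (G k y - G k x) \<le> M * \<bar>h\<bar>" using lip[of k y x] by simp
    qed (auto simp: S_def)
    then show ?thesis by (simp add: algebra_simps)
  qed
  have "convergent (\<lambda>k. G k x)" for x
  proof (rule Cauchy_convergent, rule CauchyI)
    fix e :: real assume e: "0 < e"
    \<comment> \<open>The difference quotients with step \<open>h\<close> converge and are within \<open>e / 4\<close> of the derivatives.\<close>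
    define h where "h = e / (4 * (M + 1))"
    have h: "0 < h" "M * h \<le> e / 4" using e M by (auto simp: h_def field_simps)
    define Q where "Q k = (F k (x + h) - F k x) / h" for k
    have "Q \<longlonglongrightarrow> (\<xi> (x + h) - \<xi> x) / h"
      unfolding Q_def by (intro tendsto_intros lim) (use h in simp)
    then have "Cauchy Q" by (rule LIMSEQ_imp_Cauchy)
    then obtain K where K: "\<And>k l. k \<ge> K \<Longrightarrow> l \<ge> K \<Longrightarrow> norm (Q k - Q l) < e / 2"
      using e unfolding Cauchy_iff by (meson half_gt_zero)
    have QG: "\<bar>Q k - G k x\<bar> \<le> e / 4" for k
    proof -
      have "Q k - G k x = (F k (x + h) - F k x - h * G k x) / h" using h by (simp add: Q_def field_simps)
      then have "\<bar>Q k - G k x\<bar> = \<bar>F k (x + h) - F k x - h * G k x\<bar> / h" using h by simp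
      also have "\<dots> \<le> (M * \<bar>h\<bar> * \<bar>h\<bar>) / h" using h by (intro divide_right_mono taylor) auto
      also have "\<dots> = M * h" using h by simp
      finally show ?thesis using h by linarith
    qed
    have "norm (G k x - G l x) < e" if "k \<ge> K" "l \<ge> K" for k l
      using K[OF that] QG[of k] QG[of l] e unfolding real_norm_def by linarith
    then show "\<exists>K. \<forall>k\<ge>K. \<forall>l\<ge>K. norm (G k x - G l x) < e" by blast
  qed
  then obtain g where g: "\<And>x. (\<lambda>k. G k x) \<longlonglongrightarrow> g x"
    unfolding convergent_def by metis
  have limit_taylor: "\<bar>\<xi> (x + h) - \<xi> x - h * g x\<bar> \<le> M * \<bar>h\<bar> * \<bar>h\<bar>" for x h
    by (rule tendsto_upperbound[of "\<lambda>k. \<bar>F k (x + h) - F k x - h * G k x\<bar>" _ sequentially])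
      (intro tendsto_intros lim g | simp add: taylor)+
  have "(\<xi> has_real_derivative g x) (at x)" for x
  proof -
    have "(\<lambda>h. (\<xi> (x + h) - \<xi> x) / h - g x) \<midarrow>0\<rightarrow> 0"
    proof (rule Lim_null_comparison)
      show "\<forall>\<^sub>F h in at 0. norm ((\<xi> (x + h) - \<xi> x) / h - g x) \<le> M * \<bar>h\<bar>"
        unfolding eventually_at
      proof (intro exI[of _ 1] conjI ballI impI)
        fix h :: real assume "h \<noteq> 0 \<and> dist h 0 < 1"
        then have h: "h \<noteq> 0" by simp
        have "(\<xi> (x + h) - \<xi> x) / h - g x = (\<xi> (x + h) - \<xi> x - h * g x) / h" using h by (simp add: field_simps)
        then have "norm ((\<xi> (x + h) - \<xi> x) / h - g x) = \<bar>\<xi> (x + h) - \<xi> x - h * g x\<bar> / \<bar>h\<bar>" by simp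
        also have "\<dots> \<le> (M * \<bar>h\<bar> * \<bar>h\<bar>) / \<bar>h\<bar>" by (intro divide_right_mono limit_taylor) auto
        finally show "norm ((\<xi> (x + h) - \<xi> x) / h - g x) \<le> M * \<bar>h\<bar>" using h by simp
      qed simp
      have "((\<lambda>h. M * \<bar>h\<bar>) \<longlongrightarrow> M * \<bar>0\<bar>) (at (0::real))" by (intro tendsto_intros)
      then show "((\<lambda>h. M * \<bar>h\<bar>) \<longlongrightarrow> 0) (at (0::real))" by simp
    qed
    then show ?thesis unfolding DERIV_def by (simp add: LIM_zero_iff)
  qed
  moreover have "\<bar>g x - g y\<bar> \<le> M * \<bar>x - y\<bar>" for x y
    by (rule tendsto_upperbound[of "\<lambda>k. \<bar>G k x - G k y\<bar>" _ sequentially])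
      (intro tendsto_intros g | simp add: lip)+
  ultimately show ?thesis using g that by blast
qed

text \<open>A sequence of Bethe systems of growing size and limiting density \<open>d\<close> whose counting functions
  converge pointwise. The relation between \<open>b\<close> and \<open>c\<close> is the one that holds between the limits of
  \<open>\<kappa>\<^sub>t\<close> and \<open>\<theta>\<^sub>t\<close> at infinity.\<close>

locale bethe_limit =
  fixes b c d :: real and N n :: "nat \<Rightarrow> nat" and a :: "nat \<Rightarrow> nat \<Rightarrow> real" and \<xi> :: "real \<Rightarrow> real"
  assumes system: "\<And>k. bethe_system b c (N k) (n k) (a k)"
    and arctan_c: "2 * arctan c = pi - 2 * (2 * arctan b)"
    and d: "0 \<le> d" "d \<le> 1 / 2"
    and N_lim: "filterlim N at_top sequentially"
    and n_le: "\<And>k. real (n k) \<le> real (N k) / 2 + 1"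
    and ratio: "(\<lambda>k. real (n k) / real (N k)) \<longlonglongrightarrow> d"
    and limit: "\<And>x. (\<lambda>k. counting b c (N k) (n k) (a k) x) \<longlonglongrightarrow> \<xi> x"
begin

sublocale bethe_system b c "N k" "n k" "a k" for k by (rule system)

lemma inverse_N: "(\<lambda>k. 1 / real (N k)) \<longlonglongrightarrow> 0"
  by (intro tendsto_divide_0[OF tendsto_const] filterlim_at_top_imp_at_infinity
      filterlim_compose[OF filterlim_real_sequentially N_lim])

lemma ratio_shift: "(\<lambda>k. (real (n k) + r) / real (N k)) \<longlonglongrightarrow> d"
  using tendsto_add[OF ratio tendsto_mult[OF tendsto_const[of r] inverse_N]]
  by (simp add: add_divide_distrib)

lemma ratio_half: "(\<lambda>k. (real (n k) + 1) / (2 * real (N k))) \<longlonglongrightarrow> d / 2"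
  using tendsto_divide[OF ratio_shift[of 1] tendsto_const[of 2]] by (simp add: mult.commute)

lemma \<xi>_0: "\<xi> 0 = d / 2"
  using LIMSEQ_unique[OF limit[of 0]] ratio_half by (simp add: Xi_0)

lemma \<xi>_less: "x < y \<Longrightarrow> \<xi> x < \<xi> y"
proof -
  assume xy: "x < y"
  have "(phase b y - phase b x) / (2 * pi) \<le> \<xi> y - \<xi> x"
    by (rule tendsto_lowerbound[OF tendsto_diff[OF limit limit]])
      (use xy Xi_diff_ge[of x y] in auto)
  moreover have "0 < (phase b y - phase b x) / (2 * pi)"
    using phase_strict_mono[OF b_pos xy] by simp
  ultimately show ?thesis by linarith
qed

lemma \<xi>_less_iff: "\<xi> x < \<xi> y \<longleftrightarrow> x < y"
  using \<xi>_less by (metis linorder_neqE_linordered_idom order_less_asym)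

lemma \<xi>_le: "x \<le> y \<Longrightarrow> \<xi> x \<le> \<xi> y"
  using \<xi>_less_iff[of y x] by linarith

lemma inj_\<xi>: "inj \<xi>"
  by (rule injI) (metis \<xi>_less_iff linorder_neqE_linordered_idom order_less_irrefl)

lemma ratio_le: "real (n k) / real (N k) \<le> 3 / 2"
proof -
  have "1 \<le> real (N k)" using N_pos[of k] by linarith
  then have "real (n k) \<le> 3 / 2 * real (N k)" using n_le[of k] by linarith
  then show ?thesis using N_pos[of k] by (simp add: divide_le_eq)
qed

text \<open>A bound on the slopes of all the counting functions. The factor \<open>3 / 2\<close> bounds \<open>n k / N k\<close>:
  \<open>n k \<le> N k / 2 + 1 \<le> 3 / 2 * N k\<close>.\<close>

definition slope_bound where "slope_bound = (b + 3 / 2 * c) / (2 * pi)"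

lemma slope_bound_pos: "0 < slope_bound"
  using b_pos c_pos by (simp add: slope_bound_def)

lemma Xi'_le_slope_bound: "counting' b c (N k) (n k) (a k) x \<le> slope_bound"
proof -
  have "(b + real (n k) / real (N k) * c) / (2 * pi) \<le> slope_bound"
    unfolding slope_bound_def using ratio_le c_pos by (intro divide_right_mono add_left_mono mult_right_mono) auto
  then show ?thesis using Xi'_bounds(2)[of k x] by linarith
qed

lemma \<xi>_has_derivative:
  obtains g where "\<And>x. (\<xi> has_real_derivative g x) (at x)" "continuous_on UNIV g"
    "\<And>x. 0 \<le> g x" "\<And>x. g x \<le> slope_bound"
proof -
  define M where "M = (b * (1 + b\<^sup>2) + 3 / 2 * (c * (1 + c\<^sup>2))) / (2 * pi)"
  have lip: "\<bar>counting' b c (N k) (n k) (a k) x - counting' b c (N k) (n k) (a k) y\<bar> \<le> M * \<bar>x - y\<bar>" for k x y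
  proof -
    have "0 \<le> c * (1 + c\<^sup>2)" using c_pos by simp
    then have "(b * (1 + b\<^sup>2) + real (n k) / real (N k) * (c * (1 + c\<^sup>2))) / (2 * pi) \<le> M"
      unfolding M_def using ratio_le
      by (intro divide_right_mono add_left_mono mult_right_mono) auto
    then have "(b * (1 + b\<^sup>2) + real (n k) / real (N k) * (c * (1 + c\<^sup>2))) / (2 * pi) * \<bar>x - y\<bar> \<le> M * \<bar>x - y\<bar>"
      by (intro mult_right_mono) auto
    then show ?thesis using Xi'_Lipschitz[of k x y] by linarith
  qed
  obtain g where g: "\<And>x. (\<xi> has_real_derivative g x) (at x)"
    "\<And>x. (\<lambda>k. counting' b c (N k) (n k) (a k) x) \<longlonglongrightarrow> g x"
    "\<And>x y. \<bar>g x - g y\<bar> \<le> M * \<bar>x - y\<bar>"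
    using derivative_of_limit_Lipschitz[OF has_real_derivative_Xi lip limit] by blast
  have M: "0 \<le> M" using g(3)[of 0 1] by simp
  have "M-lipschitz_on UNIV g"
    using g(3) M by (intro lipschitz_onI) (auto simp: dist_real_def)
  then have "continuous_on UNIV g" by (rule lipschitz_on_continuous_on)
  moreover have "0 \<le> g x" for x
    by (rule tendsto_lowerbound[OF g(2)]) (auto simp: Xi'_bounds)
  moreover have "g x \<le> slope_bound" for x
    by (rule tendsto_upperbound[OF g(2)]) (auto simp: Xi'_le_slope_bound)
  ultimately show ?thesis using g(1) that by blast
qed

lemma isCont_\<xi>: "isCont \<xi> x"
  using \<xi>_has_derivative DERIV_isCont by metis

lemma \<xi>_upper: "\<xi> x \<le> 2 * arctan b / (2 * pi) + d / 2 + d * ((pi - 2 * (2 * arctan b)) / (2 * pi))"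
proof (rule tendsto_le[OF _ _ limit])
  show "(\<lambda>k. 2 * arctan b / (2 * pi) + (real (n k) + 1) / (2 * real (N k))
      + real (n k) / real (N k) * (2 * arctan c / (2 * pi)))
    \<longlonglongrightarrow> 2 * arctan b / (2 * pi) + d / 2 + d * ((pi - 2 * (2 * arctan b)) / (2 * pi))"
    unfolding arctan_c by (intro tendsto_add tendsto_mult tendsto_const ratio ratio_half)
qed (use Xi_upper in auto)

lemma \<xi>_less_half:
  assumes "d = 1 / 2"
  shows "\<xi> x < 1 / 2"
proof -
  have "\<xi> (x + 1) \<le> 1 / 2" using \<xi>_upper[of "x + 1"] unfolding assms by (simp add: field_simps)
  then show ?thesis using \<xi>_less[of x "x + 1"] by linarith
qed

text \<open>No root mass escapes to infinity. Let \<open>L\<close> be the supremum of \<open>\<xi>\<close> and suppose \<open>L \<le> d\<close>.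
  About \<open>N k * (2 * \<xi> R - d)\<close> of the roots lie in \<open>[- R, R]\<close>, and the lower bound for the counting
  functions, in the limit \<open>x \<rightarrow> \<infinity>\<close> followed by \<open>R \<rightarrow> \<infinity>\<close>, becomes
  \<open>L \<ge> P / (2 * pi) + d / 2 + (2 * L - d) * (pi - 2 * P) / (2 * pi)\<close> with \<open>P = 2 * arctan b\<close>, that is,
  \<open>L \<ge> 1 / 4 + d / 2\<close>. As \<open>d \<le> 1 / 2\<close>, this is at least \<open>d\<close>, and more than \<open>d\<close> if \<open>d < 1 / 2\<close>.\<close>

lemma \<xi>_exceeds:
  assumes v: "v \<le> d" "v < 1 / 4 + d / 2"
  obtains R where "v < \<xi> R"
proof (rule ccontr)
  assume "\<not> thesis"
  with that have le: "\<xi> R \<le> v" for R by (meson not_le)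
  define P where "P = 2 * arctan b"
  define L where "L = Sup (range \<xi>)"
  have bdd: "bdd_above (range \<xi>)" using le by (intro bdd_aboveI) auto
  have L: "\<xi> R \<le> L" for R unfolding L_def by (intro cSup_upper bdd) auto
  have Lv: "L \<le> v" unfolding L_def using le by (intro cSup_least) auto
  have P: "0 < pi - 2 * P" "0 < P"
    using arctan_c c_pos b_pos zero_less_arctan_iff[of c] zero_less_arctan_iff[of b]
    unfolding P_def by linarith+
  have lower: "phase b x / (2 * pi) + d / 2 + (2 * \<xi> R - d) * phase c (x - R) / (2 * pi) \<le> L"
    if R: "0 \<le> R" "R \<le> x" for R x
  proof -
    have "\<xi> R < d" using \<xi>_less[of R "R + 1"] le[of "R + 1"] v by linarith
    then have "0 < d - \<xi> R" by simp
    have "(\<lambda>k. (real (n k) + 1) / real (N k) - counting b c (N k) (n k) (a k) R) \<longlonglongrightarrow> d - \<xi> R"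
      by (intro tendsto_diff ratio_shift limit)
    from order_tendstoD(1)[OF this \<open>0 < d - \<xi> R\<close>]
    have "\<forall>\<^sub>F k in sequentially. counting b c (N k) (n k) (a k) R < (real (n k) + 1) / real (N k)"
      by eventually_elim simp
    then have "\<forall>\<^sub>F k in sequentially. phase b x / (2 * pi) + (real (n k) + 1) / (2 * real (N k))
      + (2 * counting b c (N k) (n k) (a k) R - (real (n k) + 2) / real (N k)) * phase c (x - R) / (2 * pi)
      \<le> counting b c (N k) (n k) (a k) x"
      by eventually_elim (rule Xi_lower[OF R])
    then have "phase b x / (2 * pi) + d / 2 + (2 * \<xi> R - d) * phase c (x - R) / (2 * pi) \<le> \<xi> x"
      by (rule tendsto_le[OF sequentially_bot limit, rotated])
        (intro tendsto_add tendsto_mult tendsto_diff tendsto_divide tendsto_const ratio_half ratio_shift limit, simp)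
    then show ?thesis using L[of x] by linarith
  qed
  have lower': "P / (2 * pi) + d / 2 + (2 * \<xi> R - d) * (pi - 2 * P) / (2 * pi) \<le> L" if R: "0 \<le> R" for R
  proof (rule tendsto_upperbound[of "\<lambda>x. phase b x / (2 * pi) + d / 2 + (2 * \<xi> R - d) * phase c (x - R) / (2 * pi)"])
    have "filterlim (\<lambda>x. - R + x) at_top (at_top :: real filter)"
      by (rule filterlim_tendsto_add_at_top[OF tendsto_const filterlim_ident])
    then have "((\<lambda>x. phase c (x - R)) \<longlongrightarrow> pi - 2 * P) at_top"
      using filterlim_compose[OF phase_tendsto_at_top[of c]] arctan_c by (simp add: P_def)
    moreover have "(phase b \<longlongrightarrow> P) at_top" using phase_tendsto_at_top[of b] by (simp add: P_def)
    ultimately show "((\<lambda>x. phase b x / (2 * pi) + d / 2 + (2 * \<xi> R - d) * phase c (x - R) / (2 * pi)) \<longlongrightarrow>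
        P / (2 * pi) + d / 2 + (2 * \<xi> R - d) * (pi - 2 * P) / (2 * pi)) at_top"
      by (intro tendsto_add tendsto_mult tendsto_divide tendsto_const) auto
    show "\<forall>\<^sub>F x in at_top. phase b x / (2 * pi) + d / 2 + (2 * \<xi> R - d) * phase c (x - R) / (2 * pi) \<le> L"
      using eventually_ge_at_top[of R] by eventually_elim (rule lower[OF R])
  qed auto
  define Z where "Z = (2 * pi * L - P - pi * d) / (pi - 2 * P)"
  have Z: "2 * \<xi> R - d \<le> Z" if "0 \<le> R" for R
  proof -
    have "2 * pi * (P / (2 * pi) + d / 2 + (2 * \<xi> R - d) * (pi - 2 * P) / (2 * pi)) \<le> 2 * pi * L"
      using lower'[OF that] by (intro mult_left_mono) auto
    also have "2 * pi * (P / (2 * pi) + d / 2 + (2 * \<xi> R - d) * (pi - 2 * P) / (2 * pi))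
        = P + pi * d + (2 * \<xi> R - d) * (pi - 2 * P)" by (simp add: field_simps)
    finally show ?thesis unfolding Z_def using P by (simp add: le_divide_eq)
  qed
  have "\<xi> R \<le> (Z + d) / 2" for R
    using \<xi>_le[of R "max R 0"] Z[of "max R 0"] by simp
  then have "L \<le> (Z + d) / 2" unfolding L_def by (intro cSup_least) auto
  then have "2 * L - d \<le> Z" by simp
  then have "(2 * L - d) * (pi - 2 * P) \<le> 2 * pi * L - P - pi * d"
    unfolding Z_def using P by (simp add: le_divide_eq)
  then have "P * (2 * d + 1) \<le> P * (4 * L)" by (simp add: algebra_simps)
  then have "2 * d + 1 \<le> 4 * L" using P by simp
  then show False using Lv v by linarith
qed

text \<open>The right end of the interval of integration, characterised below by \<open>x < X\<close> if and only if
  \<open>\<xi> x < d\<close>.\<close>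

abbreviation X :: ereal where "X \<equiv> xi_inv \<xi> d"

lemma inv_\<xi> [simp]: "inv \<xi> (\<xi> x) = x"
  using inj_\<xi> by (rule inv_f_f)

lemma \<xi>_attains:
  assumes "d / 2 \<le> v" "v < \<xi> R"
  obtains y where "\<xi> y = v"
proof -
  have "0 \<le> R" using assms \<xi>_less_iff[of R 0] \<xi>_0 by linarith
  then have "\<exists>y\<ge>0. y \<le> R \<and> \<xi> y = v"
    using assms isCont_\<xi> \<xi>_0 by (intro IVT) auto
  then show ?thesis using that by blast
qed

lemma less_X_iff: "ereal x < X \<longleftrightarrow> \<xi> x < d"
proof (cases "d = 1 / 2")
  case True
  then show ?thesis using \<xi>_less_half[of x] by (simp add: xi_inv_def)
next
  case False
  then obtain R where "d < \<xi> R" using \<xi>_exceeds[of d] d by auto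
  then obtain y where "\<xi> y = d" using \<xi>_attains[of d] d by auto
  then show ?thesis using False inv_\<xi>[of y] \<xi>_less_iff[of x y] by (simp add: xi_inv_def)
qed

lemma \<xi>_attains_between:
  assumes "d / 2 < v" "v < d"
  obtains y where "0 < y" "ereal y < X" "\<xi> y = v"
proof -
  obtain R where "v < \<xi> R" using \<xi>_exceeds[of v] assms d by auto
  then obtain y where y: "\<xi> y = v" using \<xi>_attains[of v] assms by auto
  then show ?thesis using that[of y] assms \<xi>_less_iff[of 0 y] \<xi>_0 less_X_iff[of y] by auto
qed

lemma \<xi>_tendsto_at_left_X:
  assumes "0 < d"
  shows "((ereal \<circ> (\<lambda>x. \<xi> x - d / 2) \<circ> real_of_ereal) \<longlongrightarrow> ereal (d / 2)) (at_left X)"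
proof (cases "d = 1 / 2")
  case True
  have "(\<xi> \<longlongrightarrow> d) at_top"
  proof (rule order_tendstoI)
    fix v assume "v < d"
    then obtain R where R: "v < \<xi> R" using \<xi>_exceeds[of v] True by auto
    show "\<forall>\<^sub>F x in at_top. v < \<xi> x"
      using eventually_ge_at_top[of R] by eventually_elim (use R \<xi>_le order_less_le_trans in blast)
  next
    fix v assume "d < v"
    then show "\<forall>\<^sub>F x in at_top. \<xi> x < v"
      using \<xi>_less_half[OF True] True by (intro always_eventually allI) (meson less_trans)
  qed
  then have "((\<lambda>x. \<xi> x - d / 2) \<longlongrightarrow> d - d / 2) at_top" by (intro tendsto_intros)
  moreover have "X = \<infinity>" using True by (simp add: xi_inv_def)
  ultimately show ?thesis by (simp add: ereal_tendsto_simps)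
next
  case False
  then obtain R where "d < \<xi> R" using \<xi>_exceeds[of d] d by auto
  then obtain y where y: "\<xi> y = d" using \<xi>_attains[of d] d by auto
  have "((\<lambda>x. \<xi> x - d / 2) \<longlongrightarrow> \<xi> y - d / 2) (at_left y)"
    using isCont_\<xi>[of y] by (intro tendsto_diff tendsto_const) (simp add: isCont_def filterlim_at_split)
  then show ?thesis
    using False y inv_\<xi>[of y] by (auto simp add: xi_inv_def ereal_tendsto_simps)
qed

lemma X_pos: "0 < d \<Longrightarrow> 0 < X"
  using less_X_iff[of 0] \<xi>_0 by (simp add: zero_ereal_def)

text \<open>As the counting functions are monotone and take the value \<open>j / N k\<close> at the \<open>j\<close>-th root,
  pointwise convergence to the strictly increasing \<open>\<xi>\<close> suffices here.\<close>

lemma root_sequence_tendsto: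
  assumes j: "\<And>k. K \<le> k \<Longrightarrow> j k \<in> {1..n k}" and lim: "(\<lambda>k. real (j k) / real (N k)) \<longlonglongrightarrow> \<xi> y"
  shows "(\<lambda>k. a k (j k)) \<longlonglongrightarrow> y"
proof (rule order_tendstoI)
  have ev: "\<forall>\<^sub>F k in sequentially. counting b c (N k) (n k) (a k) (a k (j k)) = real (j k) / real (N k)"
    using eventually_ge_at_top[of K] by eventually_elim (rule Xi_root[OF j])
  {
    fix z assume "z < y"
    then have "\<xi> z < \<xi> y" by (rule \<xi>_less)
    then have "0 < \<xi> y - \<xi> z" by simp
    from order_tendstoD(1)[OF tendsto_diff[OF lim limit] this] ev
    show "\<forall>\<^sub>F k in sequentially. z < a k (j k)"
    proof eventually_elim
      case (elim k)
      then show ?case using Xi_less_iff[of k z "a k (j k)"] by simp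
    qed
  next
    fix z assume "y < z"
    then have "\<xi> y < \<xi> z" by (rule \<xi>_less)
    then have "0 < \<xi> z - \<xi> y" by simp
    from order_tendstoD(1)[OF tendsto_diff[OF limit lim] this] ev
    show "\<forall>\<^sub>F k in sequentially. a k (j k) < z"
    proof eventually_elim
      case (elim k)
      then show ?case using Xi_less_iff[of k "a k (j k)" z] by simp
    qed
  }
qed

section \<open>Sums over the upper half of the roots\<close>

text \<open>The sum runs over the \<open>upper k\<close> roots with indices \<open>half k + i\<close>, \<open>1 \<le> i \<le> upper k\<close>.\<close>

definition half :: "nat \<Rightarrow> nat" where "half k = nat \<lceil>real (n k) / 2\<rceil>"

definition upper :: "nat \<Rightarrow> nat" where "upper k = n k - half k"

lemma half_le: "half k \<le> n k"
  unfolding half_def by linarith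

text \<open>The step function with value \<open>f\<close> at the \<open>i\<close>-th of these roots on the \<open>i\<close>-th interval of length
  \<open>1 / N k\<close>; its integral is the sum in question.\<close>

definition step :: "(real \<Rightarrow> real) \<Rightarrow> nat \<Rightarrow> real \<Rightarrow> real" where
  "step f k u = (\<Sum>i=1..upper k. f (a k (half k + i)) * indicat_real {(real i - 1) / real (N k)<..real i / real (N k)} u)"

lemma integral_step:
  "integrable lborel (step f k)"
  "(LBINT u. step f k u) = 1 / real (N k) * (\<Sum>j = nat \<lceil>real (n k) / 2\<rceil> + 1..n k. f (a k j))"
proof -
  have N: "real (N k) > 0" using N_pos[of k] by simp
  have le: "(real i - 1) / real (N k) \<le> real i / real (N k)" for i
    using N by (intro divide_right_mono) auto
  have int: "integrable lborel (\<lambda>u. f (a k (half k + i)) * indicat_real {(real i - 1) / real (N k)<..real i / real (N k)} u)" for i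
    using le by (intro integrable_mult_right integrable_real_indicator) auto
  then show "integrable lborel (step f k)"
    unfolding step_def by (intro Bochner_Integration.integrable_sum)
  have "(LBINT u. step f k u) = (\<Sum>i=1..upper k. f (a k (half k + i)) * (1 / real (N k)))"
    unfolding step_def Bochner_Integration.integral_sum[OF int]
  proof (intro sum.cong refl)
    fix i
    have "measure lborel {(real i - 1) / real (N k)<..real i / real (N k)} = 1 / real (N k)"
      using le[of i] by (simp add: diff_divide_distrib)
    then show "(LBINT u. f (a k (half k + i)) * indicat_real {(real i - 1) / real (N k)<..real i / real (N k)} u)
       = f (a k (half k + i)) * (1 / real (N k))" by simp
  qed
  also have "\<dots> = 1 / real (N k) * (\<Sum>i=1..upper k. f (a k (half k + i)))"
    by (simp add: sum_distrib_left mult.commute)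
  also have "(\<Sum>i=1..upper k. f (a k (half k + i))) = (\<Sum>j=half k + 1..n k. f (a k j))"
    using half_le[of k] by (intro sum.reindex_bij_witness[of _ "\<lambda>j. j - half k" "\<lambda>i. half k + i"]) (auto simp: upper_def)
  finally show "(LBINT u. step f k u) = 1 / real (N k) * (\<Sum>j = nat \<lceil>real (n k) / 2\<rceil> + 1..n k. f (a k j))"
    by (simp add: half_def)
qed

lemma step_eq:
  "step f k u = (if 0 < u \<and> nat \<lceil>real (N k) * u\<rceil> \<le> upper k then f (a k (half k + nat \<lceil>real (N k) * u\<rceil>)) else 0)"
proof -
  have N: "real (N k) > 0" using N_pos[of k] by simp
  have iff: "u \<in> {(real i - 1) / real (N k)<..real i / real (N k)} \<longleftrightarrow> 0 < u \<and> i = nat \<lceil>real (N k) * u\<rceil>"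
    if "1 \<le> i" for i
  proof -
    have "u \<in> {(real i - 1) / real (N k)<..real i / real (N k)} \<longleftrightarrow>
        real i - 1 < real (N k) * u \<and> real (N k) * u \<le> real i"
      using N by (simp add: divide_less_eq le_divide_eq mult.commute)
    also have "\<dots> \<longleftrightarrow> \<lceil>real (N k) * u\<rceil> = int i" by (simp add: ceiling_eq_iff)
    also have "\<dots> \<longleftrightarrow> 0 < u \<and> i = nat \<lceil>real (N k) * u\<rceil>"
    proof -
      have "0 < u \<longleftrightarrow> 0 < \<lceil>real (N k) * u\<rceil>" using N by (simp add: zero_less_mult_iff)
      then show ?thesis using that by linarith
    qed
    finally show ?thesis .
  qed
  have "step f k u = (\<Sum>i=1..upper k. if i = nat \<lceil>real (N k) * u\<rceil> then
      (if 0 < u then f (a k (half k + i)) else 0) else 0)"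
    unfolding step_def
  proof (intro sum.cong refl)
    fix i assume "i \<in> {1..upper k}"
    then have "1 \<le> i" by simp
    then show "f (a k (half k + i)) * indicat_real {(real i - 1) / real (N k)<..real i / real (N k)} u =
      (if i = nat \<lceil>real (N k) * u\<rceil> then (if 0 < u then f (a k (half k + i)) else 0) else 0)"
      using iff by (simp only: indicator_def) auto
  qed
  also have "\<dots> = (if nat \<lceil>real (N k) * u\<rceil> \<in> {1..upper k} then
      (if 0 < u then f (a k (half k + nat \<lceil>real (N k) * u\<rceil>)) else 0) else 0)"
    by (simp only: sum.delta finite_atLeastAtMost)
  also have "\<dots> = (if 0 < u \<and> nat \<lceil>real (N k) * u\<rceil> \<le> upper k then f (a k (half k + nat \<lceil>real (N k) * u\<rceil>)) else 0)"
  proof -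
    have "1 \<le> nat \<lceil>real (N k) * u\<rceil>" if "0 < u"
    proof -
      have "0 < real (N k) * u" using that N by simp
      then show ?thesis by linarith
    qed
    then show ?thesis by auto
  qed
  finally show ?thesis .
qed

lemma upper_ratio: "(\<lambda>k. real (upper k) / real (N k)) \<longlonglongrightarrow> d / 2"
  and half_ratio: "(\<lambda>k. real (half k) / real (N k)) \<longlonglongrightarrow> d / 2"
proof -
  have h: "real (n k) / 2 \<le> real (half k)" "real (half k) \<le> (real (n k) + 2) / 2" for k
  proof -
    have "real (half k) = of_int \<lceil>real (n k) / 2\<rceil>" by (simp add: half_def)
    then show "real (n k) / 2 \<le> real (half k)" "real (half k) \<le> (real (n k) + 2) / 2"
      using le_of_int_ceiling[of "real (n k) / 2"] of_int_ceiling_le_add_one[of "real (n k) / 2"]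
      by (simp_all only: add_divide_distrib)
  qed
  have "(\<lambda>k. (real (n k) + r) / real (N k) / 2) \<longlonglongrightarrow> d / 2" for r
    by (rule tendsto_divide[OF ratio_shift tendsto_const]) simp
  note lims = this[of 0] this[of 2]
  have bounds: "(real (n k) + 0) / real (N k) / 2 \<le> real (half k) / real (N k)"
    "real (half k) / real (N k) \<le> (real (n k) + 2) / real (N k) / 2" for k
    using divide_right_mono[OF h(1)[of k], of "real (N k)"] divide_right_mono[OF h(2)[of k], of "real (N k)"]
    by (simp_all add: mult.commute)
  show hr: "(\<lambda>k. real (half k) / real (N k)) \<longlonglongrightarrow> d / 2"
    by (rule tendsto_sandwich[OF _ _ lims]) (intro always_eventually allI bounds)+
  have "(\<lambda>k. real (n k) / real (N k) - real (half k) / real (N k)) \<longlonglongrightarrow> d - d / 2"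
    by (intro tendsto_diff ratio hr)
  moreover have "real (upper k) = real (n k) - real (half k)" for k
    using half_le by (simp add: upper_def of_nat_diff)
  ultimately show "(\<lambda>k. real (upper k) / real (N k)) \<longlonglongrightarrow> d / 2"
    by (simp add: diff_divide_distrib)
qed

lemma ceiling_ratio:
  assumes "0 < u"
  shows "(\<lambda>k. real (nat \<lceil>real (N k) * u\<rceil>) / real (N k)) \<longlonglongrightarrow> u"
proof (rule real_tendsto_sandwich[of "\<lambda>_. u" _ _ "\<lambda>k. u + 1 / real (N k)"])
  have N: "real (N k) > 0" for k using N_pos[of k] by simp
  have i: "real (N k) * u \<le> real (nat \<lceil>real (N k) * u\<rceil>)" "real (nat \<lceil>real (N k) * u\<rceil>) \<le> real (N k) * u + 1" for k
  proof -
    have "0 < real (N k) * u" using N assms by simp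
    then show "real (N k) * u \<le> real (nat \<lceil>real (N k) * u\<rceil>)" "real (nat \<lceil>real (N k) * u\<rceil>) \<le> real (N k) * u + 1"
      by linarith+
  qed
  show "\<forall>\<^sub>F k in sequentially. u \<le> real (nat \<lceil>real (N k) * u\<rceil>) / real (N k)"
    using i N by (simp add: le_divide_eq mult.commute)
  have "real (nat \<lceil>real (N k) * u\<rceil>) / real (N k) \<le> u + 1 / real (N k)" for k
    using divide_right_mono[OF i(2)[of k], of "real (N k)"] N[of k] by (simp add: add_divide_distrib)
  then show "\<forall>\<^sub>F k in sequentially. real (nat \<lceil>real (N k) * u\<rceil>) / real (N k) \<le> u + 1 / real (N k)" by simp
  show "(\<lambda>k. u + 1 / real (N k)) \<longlonglongrightarrow> u"
    using tendsto_add[OF tendsto_const[of u] inverse_N] by simp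
qed simp

text \<open>For \<open>0 < u < d / 2\<close> the root used at \<open>u\<close> has an index \<open>j\<close> with \<open>j / N k \<rightarrow> d / 2 + u\<close>, so it
  tends to the point where \<open>\<xi>\<close> takes this value. At \<open>u = d / 2\<close> nothing is claimed, because
  \<open>upper k / N k\<close> may approach \<open>d / 2\<close> from either side.\<close>

lemma step_tendsto:
  assumes f: "continuous_on {0<..} f" and u: "u \<noteq> d / 2"
  shows "(\<lambda>k. step f k u) \<longlonglongrightarrow> indicat_real {0<..<d / 2} u * f (inv \<xi> (d / 2 + u))"
proof -
  consider "u \<le> 0" | "0 < u" "d / 2 < u" | "0 < u" "u < d / 2" using u by linarith
  then show ?thesis
  proof cases
    case 1
    then show ?thesis by (simp add: step_eq)
  next
    case 2
    then have "0 < u - d / 2" by simp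
    from order_tendstoD(1)[OF tendsto_diff[OF ceiling_ratio[OF 2(1)] upper_ratio] this]
    have "\<forall>\<^sub>F k in sequentially. step f k u = 0"
    proof eventually_elim
      case (elim k)
      then have "real (upper k) / real (N k) < real (nat \<lceil>real (N k) * u\<rceil>) / real (N k)" by simp
      then have "upper k < nat \<lceil>real (N k) * u\<rceil>" using N_pos[of k] by (simp add: divide_less_cancel)
      then have "\<not> nat \<lceil>real (N k) * u\<rceil> \<le> upper k" by linarith
      then show ?case by (simp only: step_eq simp_thms if_False)
    qed
    then have "(\<lambda>k. step f k u) \<longlonglongrightarrow> 0" by (rule tendsto_eventually)
    then show ?thesis using 2 by simp
  next
    case 3
    obtain y where y: "0 < y" "\<xi> y = d / 2 + u" using \<xi>_attains_between[of "d / 2 + u"] 3 by auto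
    have "0 < d / 2 - u" using 3 by simp
    from order_tendstoD(1)[OF tendsto_diff[OF upper_ratio ceiling_ratio[OF 3(1)]] this]
    have ev: "\<forall>\<^sub>F k in sequentially. nat \<lceil>real (N k) * u\<rceil> \<le> upper k"
    proof eventually_elim
      case (elim k)
      then have "real (nat \<lceil>real (N k) * u\<rceil>) / real (N k) < real (upper k) / real (N k)" by simp
      then have "nat \<lceil>real (N k) * u\<rceil> < upper k" using N_pos[of k] by (simp add: divide_less_cancel)
      then show ?case by (rule less_imp_le)
    qed
    then obtain K where K: "\<And>k. K \<le> k \<Longrightarrow> nat \<lceil>real (N k) * u\<rceil> \<le> upper k"
      unfolding eventually_sequentially by blast
    have "(\<lambda>k. a k (half k + nat \<lceil>real (N k) * u\<rceil>)) \<longlonglongrightarrow> y"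
    proof (rule root_sequence_tendsto[of K])
      fix k assume "K \<le> k"
      have "0 < real (N k) * u" using 3 N_pos[of k] by simp
      then have "1 \<le> nat \<lceil>real (N k) * u\<rceil>" by linarith
      then show "half k + nat \<lceil>real (N k) * u\<rceil> \<in> {1..n k}"
        using K[OF \<open>K \<le> k\<close>] half_le[of k] unfolding upper_def atLeastAtMost_iff by linarith
    next
      show "(\<lambda>k. real (half k + nat \<lceil>real (N k) * u\<rceil>) / real (N k)) \<longlonglongrightarrow> \<xi> y"
        using tendsto_add[OF half_ratio ceiling_ratio[OF 3(1)]] y by (simp add: add_divide_distrib)
    qed
    moreover have "isCont f y" using f y(1) by (simp add: continuous_on_eq_continuous_at)
    ultimately have "(\<lambda>k. f (a k (half k + nat \<lceil>real (N k) * u\<rceil>))) \<longlonglongrightarrow> f y"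
      using isCont_tendsto_compose by blast
    moreover have "\<forall>\<^sub>F k in sequentially. f (a k (half k + nat \<lceil>real (N k) * u\<rceil>)) = step f k u"
      using ev by eventually_elim (use 3 in \<open>simp add: step_eq\<close>)
    ultimately have "(\<lambda>k. step f k u) \<longlonglongrightarrow> f y" by (rule Lim_transform_eventually)
    then show ?thesis using 3 inv_\<xi>[of y] y(2) by simp
  qed
qed

lemma step_bound:
  assumes pos: "\<And>x. x > 0 \<Longrightarrow> f x > 0" and dec: "antimono_on {0<..} f"
  shows "norm (step f k u) \<le> indicat_real {0<..} u * f (u / (2 * slope_bound))"
proof (cases "0 < u")
  case True
  have fu: "0 < f (u / (2 * slope_bound))" using True slope_bound_pos by (intro pos) auto
  show ?thesis
  proof (cases "nat \<lceil>real (N k) * u\<rceil> \<le> upper k")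
    case le: True
    define i where "i = nat \<lceil>real (N k) * u\<rceil>"
    have N: "real (N k) > 0" using N_pos[of k] by simp
    have "0 < real (N k) * u" using True N by simp
    then have i: "1 \<le> i" "real (N k) * u \<le> real i" unfolding i_def by linarith+
    have "half k + i \<le> n k" using le half_le[of k] unfolding upper_def i_def by linarith
    note root = upper_half_root[OF Xi'_le_slope_bound i(1) this[unfolded half_def], folded half_def]
    have "u / 2 \<le> real i / (2 * real (N k))" using i(2) N by (simp add: le_divide_eq mult.commute)
    then have "u \<le> a k (half k + i) * (2 * slope_bound)" using root(2) by (simp only: mult_ac)
    then have "u / (2 * slope_bound) \<le> a k (half k + i)" using slope_bound_pos by (simp add: divide_le_eq)
    then have "f (a k (half k + i)) \<le> f (u / (2 * slope_bound))"
      using dec root(1) True slope_bound_pos by (auto simp: monotone_on_def)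
    moreover have "0 < f (a k (half k + i))" using pos root(1) .
    ultimately show ?thesis using True by (simp add: step_eq i_def)
  next
    case False
    then show ?thesis using True fu by (simp add: step_eq)
  qed
qed (simp add: step_eq)

text \<open>The substitution \<open>u = \<xi> \<alpha> - d / 2\<close>; the integrand on the right is integrable because \<open>\<xi>\<close> has a bounded derivative.\<close>

lemma integral_substitution_\<xi>:
  assumes pos: "\<And>x. x > 0 \<Longrightarrow> f x > 0" and cont: "continuous_on {0<..} f"
    and int: "set_integrable lborel {0<..} f" and d0: "0 < d"
  shows "set_integrable lborel {0<..<d / 2} (\<lambda>u. f (inv \<xi> (d / 2 + u)))"
    and "(LBINT u:{0<..<d / 2}. f (inv \<xi> (d / 2 + u))) = (LBINT \<alpha>=0..X. f \<alpha> * deriv \<xi> \<alpha>)"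
proof -
  obtain g where g: "\<And>x. (\<xi> has_real_derivative g x) (at x)" "continuous_on UNIV g"
    "\<And>x. 0 \<le> g x" "\<And>x. g x \<le> slope_bound" using \<xi>_has_derivative by blast
  have deriv: "deriv \<xi> = g" using g(1) DERIV_imp_deriv by blast
  have fx: "isCont f x" if "0 < x" for x
    using cont that by (simp add: continuous_on_eq_continuous_at)
  have inv_cont: "isCont (inv \<xi>) (\<xi> x)" for x
    by (rule isCont_inverse_function[of 1 x]) (use isCont_\<xi> in auto)
  have "set_integrable lborel {0<..} (\<lambda>x. f x * g x)"
    unfolding set_integrable_def
  proof (rule Bochner_Integration.integrable_bound)
    show "integrable lborel (\<lambda>x. slope_bound * (indicator {0<..} x *\<^sub>R f x))"
      using int by (intro integrable_mult_right) (simp add: set_integrable_def)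
    have "(\<lambda>x. indicator {0<..} x *\<^sub>R f x) \<in> borel_measurable lborel"
      using int unfolding set_integrable_def by (rule borel_measurable_integrable)
    moreover have "g \<in> borel_measurable lborel"
      using g(2) borel_measurable_continuous_onI by simp
    ultimately have "(\<lambda>x. (indicator {0<..} x *\<^sub>R f x) * g x) \<in> borel_measurable lborel"
      by (rule borel_measurable_times)
    then show "(\<lambda>x. indicator {0<..} x *\<^sub>R (f x * g x)) \<in> borel_measurable lborel"
      by (simp add: mult.assoc)
    show "AE x in lborel. norm (indicator {0<..} x *\<^sub>R (f x * g x)) \<le> norm (slope_bound * (indicator {0<..} x *\<^sub>R f x))"
    proof (rule AE_I2)
      fix x
      have "\<bar>f x\<bar> * \<bar>g x\<bar> \<le> \<bar>f x\<bar> * slope_bound" using g(3,4)[of x] by (intro mult_left_mono) auto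
      then show "norm (indicator {0<..} x *\<^sub>R (f x * g x)) \<le> norm (slope_bound * (indicator {0<..} x *\<^sub>R f x))"
        using slope_bound_pos by (simp add: indicator_def abs_mult mult.commute)
    qed
  qed
  then have int': "set_integrable lborel (einterval 0 X) (\<lambda>x. f x * g x)"
    by (rule set_integrable_subset) (auto simp: einterval_def zero_ereal_def)
  have lim0: "((ereal \<circ> (\<lambda>x. \<xi> x - d / 2) \<circ> real_of_ereal) \<longlongrightarrow> ereal 0) (at_right 0)"
  proof -
    have "((\<lambda>x. \<xi> x - d / 2) \<longlongrightarrow> \<xi> 0 - d / 2) (at_right 0)"
      using isCont_\<xi>[of 0] by (intro tendsto_diff tendsto_const) (simp add: isCont_def filterlim_at_split)
    then show ?thesis using \<xi>_0 by (simp add: ereal_tendsto_simps zero_ereal_def)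
  qed
  note subst = interval_integral_substitution_nonneg[of 0 X "\<lambda>x. \<xi> x - d / 2" g
      "\<lambda>u. f (inv \<xi> (d / 2 + u))" "ereal 0" "ereal (d / 2)"]
  have comp: "isCont (\<lambda>u. f (inv \<xi> (d / 2 + u))) (\<xi> x - d / 2)" if "0 < x" for x
  proof -
    have "isCont (\<lambda>u. inv \<xi> (d / 2 + u)) (\<xi> x - d / 2)"
      using inv_cont[of x] by (intro continuous_intros isCont_o2[of _ "\<lambda>u. d / 2 + u" "inv \<xi>"]) auto
    then show ?thesis using fx[OF that] by (intro isCont_o2[of _ "\<lambda>u. inv \<xi> (d / 2 + u)" f]) auto
  qed
  have prem: "\<And>x. ((\<lambda>x. \<xi> x - d / 2) has_real_derivative g x) (at x)"
    using g(1) by (auto intro!: derivative_eq_intros)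
  have gcont: "isCont g x" for x using g(2) by (simp add: continuous_on_eq_continuous_at)
  have s1: "set_integrable lborel (einterval (ereal 0) (ereal (d / 2))) (\<lambda>u. f (inv \<xi> (d / 2 + u)))"
    and s2: "(LBINT u=ereal 0..ereal (d / 2). f (inv \<xi> (d / 2 + u))) =
      (LBINT x=0..X. f (inv \<xi> (d / 2 + (\<xi> x - d / 2))) * g x)"
    by (rule subst; use X_pos[OF d0] prem comp gcont pos g(3) lim0 \<xi>_tendsto_at_left_X[OF d0] int' in
        \<open>auto simp: zero_ereal_def less_imp_le\<close>)+
  have e: "einterval (ereal 0) (ereal (d / 2)) = {0<..<d / 2}" by (auto simp: einterval_def)
  show "set_integrable lborel {0<..<d / 2} (\<lambda>u. f (inv \<xi> (d / 2 + u)))" using s1 unfolding e .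
  have "(LBINT u:{0<..<d / 2}. f (inv \<xi> (d / 2 + u))) = (LBINT u=ereal 0..ereal (d / 2). f (inv \<xi> (d / 2 + u)))"
    using d0 by (simp add: interval_lebesgue_integral_def e)
  then show "(LBINT u:{0<..<d / 2}. f (inv \<xi> (d / 2 + u))) = (LBINT \<alpha>=0..X. f \<alpha> * deriv \<xi> \<alpha>)"
    unfolding s2 deriv by simp
qed

lemma upper_half_sum_tendsto:
  assumes pos: "\<And>x. x > 0 \<Longrightarrow> f x > 0" and cont: "continuous_on {0<..} f"
    and dec: "antimono_on {0<..} f" and int: "set_integrable lborel {0<..} f"
  shows "(\<lambda>k. 1 / real (N k) * (\<Sum>j = nat \<lceil>real (n k) / 2\<rceil> + 1..n k. f (a k j)))
    \<longlonglongrightarrow> (LBINT \<alpha>=0..xi_inv \<xi> d. f \<alpha> * deriv \<xi> \<alpha>)"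
proof -
  define W where "W u = indicat_real {0<..<d / 2} u * f (inv \<xi> (d / 2 + u))" for u
  have W: "integrable lborel W \<and> (LBINT u. W u) = (LBINT \<alpha>=0..X. f \<alpha> * deriv \<xi> \<alpha>)"
  proof (cases "d = 0")
    case True
    then have "X = 0"
      using \<xi>_0 inv_\<xi>[of 0] by (simp add: xi_inv_def zero_ereal_def)
    then show ?thesis using True unfolding W_def by simp
  next
    case False
    then have "0 < d" using d by simp
    from integral_substitution_\<xi>[OF pos cont int this] show ?thesis
      by (simp add: set_integrable_def set_lebesgue_integral_def W_def[abs_def])
  qed
  have dom: "integrable lborel (\<lambda>u. indicat_real {0<..} u * f (u / (2 * slope_bound)))"
  proof -
    have "integrable lborel (\<lambda>x. indicator {0<..} x *\<^sub>R f x)" using int by (simp add: set_integrable_def)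
    from lborel_integrable_real_affine[OF this, of "1 / (2 * slope_bound)" 0]
    have "integrable lborel (\<lambda>u. indicat_real {0<..} (u / (2 * slope_bound)) * f (u / (2 * slope_bound)))" using slope_bound_pos by simp
    then show ?thesis using slope_bound_pos by (simp add: indicator_def zero_less_divide_iff)
  qed
  have "(\<lambda>k. LBINT u. step f k u) \<longlonglongrightarrow> (LBINT u. W u)"
  proof (rule integral_dominated_convergence[OF _ _ dom])
    show "W \<in> borel_measurable lborel" using W by (intro borel_measurable_integrable) simp
    show "step f k \<in> borel_measurable lborel" for k
      by (intro borel_measurable_integrable integral_step)
    show "AE u in lborel. (\<lambda>k. step f k u) \<longlonglongrightarrow> W u"
      using AE_lborel_singleton[of "d / 2"] by eventually_elim (use step_tendsto[OF cont] in \<open>simp add: W_def\<close>)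
    show "AE u in lborel. norm (step f k u) \<le> indicat_real {0<..} u * f (u / (2 * slope_bound))" for k
      using step_bound[OF pos dec] by (intro AE_I2)
  qed
  then show ?thesis using W by (simp add: integral_step)
qed

end

section \<open>Convergence for the Bethe roots\<close>

theorem theorem13:
  fixes \<Theta> :: "real \<Rightarrow> real \<Rightarrow> real \<Rightarrow> real"
    and \<kappa> :: "real \<Rightarrow> real \<Rightarrow> real"
    and t d :: real
    and N n :: "nat \<Rightarrow> nat"
    and a :: "nat \<Rightarrow> nat \<Rightarrow> real"
    and \<xi> :: "real \<Rightarrow> real"
    and f :: "real \<Rightarrow> real"
  assumes Theta: "is_Theta \<Theta>"
    and kappa: "is_kappa \<kappa>"
    and t: "t \<in> {0<..<sqrt 2}"
    and d: "d \<in> {0..1/2}"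
    and N_pos: "\<And>k. N k > 0"
    and n_pos: "\<And>k. n k > 0"
    and N_lim: "filterlim N at_top sequentially"
    and n_le: "\<And>k. real (n k) \<le> real (N k) / 2 + 1"
    and ratio: "(\<lambda>k. real (n k) / real (N k)) \<longlonglongrightarrow> d"
    and roots: "\<And>k. bethe_roots \<Theta> \<kappa> t (N k) (n k) (a k)"
    and xi: "\<And>K. compact K \<Longrightarrow>
      uniform_limit K (\<lambda>k. counting_fun \<Theta> \<kappa> t (N k) (n k) (a k)) \<xi> sequentially"
    and f_pos: "\<And>x. x > 0 \<Longrightarrow> f x > 0"
    and f_cont: "continuous_on {0<..} f"
    and f_decr: "antimono_on {0<..} f"
    and f_int: "set_integrable lborel {0<..} f"
  shows "(\<lambda>k. 1 / real (N k) * (\<Sum>j = nat \<lceil>real (n k) / 2\<rceil> + 1..n k. f (a k j)))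
    \<longlonglongrightarrow> (LBINT \<alpha>=0..xi_inv \<xi> d. f \<alpha> * deriv \<xi> \<alpha>)"
proof -
  define b where "b = cot (mu t / 2)"
  define c where "c = - cot (mu t)"
  have K: "\<kappa> t x = phase b x" for x
    unfolding b_def by (rule kappa_eq_phase[OF kappa t])
  have T: "theta \<Theta> \<kappa> t x y = phase c (x - y)" for x y
    unfolding c_def by (rule theta_eq_phase[OF Theta kappa t])
  note lims = rapidity_limits[OF t, folded b_def c_def]
  have count: "counting_fun \<Theta> \<kappa> t (N k) (n k) (a k) x = counting b c (N k) (n k) (a k) x" for k x
    unfolding counting_fun_def counting_def K T by simp
  have system: "bethe_system b c (N k) (n k) (a k)" for k
  proof
      fix j assume j: "j \<in> {1..n k}"
      have "real (N k) * \<kappa> t (a k j) =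
          2 * pi * real j - (real (n k) + 1) * pi - (\<Sum>l=1..n k. theta \<Theta> \<kappa> t (a k j) (a k l))"
        using roots[of k] j unfolding bethe_roots_def theta_def by blast
      then show "real (N k) * phase b (a k j) + (\<Sum>l=1..n k. phase c (a k j - a k l))
          = 2 * pi * real j - (real (n k) + 1) * pi"
        unfolding K T by simp
  qed (use lims N_pos in auto)
  interpret bethe_limit b c d N n a \<xi>
  proof (rule bethe_limit.intro)
    show "2 * arctan c = pi - 2 * (2 * arctan b)" using lims(1,2) by simp
    show "(\<lambda>k. counting b c (N k) (n k) (a k) x) \<longlonglongrightarrow> \<xi> x" for x
      using tendsto_uniform_limitI[OF xi[of "{x}"], of x] by (simp add: count)
  qed (use d N_lim n_le ratio system in auto)
  show ?thesis by (rule upper_half_sum_tendsto[OF f_pos f_cont f_decr f_int])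
qed

end
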